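(* Let $r:\mathbb N\to\mathbb R_{>0}$ be a function with $r(n)\to\infty$ and $r\in O(\log n)$. Then there are families of $n$-vertex hyperbolic uniform disk graphs (each containing graphs with arbitrarily large $n$) with disk radius in $\Theta(r)$ and, respectively, (i) clique number in $O(\log r)$, and both treewidth and row-treewidth in $\Omega(r)$; (ii) clique number in $O(1)$, and both treewidth and row-treewidth in $\Omega(\log r)$. That is, there is one such family satisfying (i), and one such family satisfying (ii).
   Context: Graphs are finite and simple. For $\rho>0$, a graph $G$ is a hyperbolic uniform disk graph (HUDG) with disk radius $\rho$ if its vertices can be assigned to points of the hyperbolic plane (of curvature $-1$) such that two distinct vertices are adjacent if and only if their points have hyperbolic distance at most $2\rho$. The clique number is the number of vertices of a largest complete subgraph. Asymptotics are with respect to the number $n$ of vertices, with $r=r(n)$: a family has disk radius in $\Theta(r)$ if there are constants $c_1,c_2>0$ such that every sufficiently large $n$-vertex graph $G$ of the family is a HUDG with some disk radius $r_G$ with $c_1r(n)\le r_G\le c_2r(n)$; the statements on clique number, treewidth and row-treewidth are understood analogously. The strong product $G\boxtimes H$ has vertex set $V(G)\times V(H)$, and two distinct vertices $(u_G,u_H)$, $(v_G,v_H)$ are adjacent if and only if ($u_G=v_G$ or $u_Gv_G\in E(G)$) and ($u_H=v_H$ or $u_Hv_H\in E(H)$). The row-treewidth of $G$ is the smallest $t$ such that $G$ is (isomorphic to) a subgraph of $H\boxtimes P$ for some graph $H$ of treewidth $t$ and some path $P$. *)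

theory Defs
  imports
    Complex_Main
    "HOL-Library.Landau_Symbols"
    "Graph_Theory.Graph_Theory"
begin

text \<open>
  A finite simple graph is a \<^locale>\<open>pair_graph\<close>: a finite, loop-free digraph with a symmetric
  arc relation, every undirected edge being represented by its two orientations.
\<close>

section \<open>Hyperbolic uniform disk graphs\<close>

text \<open>The hyperbolic plane of curvature \<open>-1\<close>, in the upper half-plane model.\<close>

definition hyp_plane :: "complex set" where
  "hyp_plane = {z. 0 < Im z}"

definition hyp_dist :: "complex \<Rightarrow> complex \<Rightarrow> real" where
  "hyp_dist z w = arcosh (1 + (cmod (z - w))\<^sup>2 / (2 * Im z * Im w))"

text \<open>Distinct vertices may be assigned the same point.\<close>

definition hudg :: "real \<Rightarrow> 'a pair_pre_digraph \<Rightarrow> bool" where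
  "hudg \<rho> G \<longleftrightarrow> pair_graph G \<and> 0 < \<rho> \<and>
    (\<exists>p. (\<forall>v\<in>pverts G. p v \<in> hyp_plane) \<and>
         (\<forall>u\<in>pverts G. \<forall>v\<in>pverts G. u \<noteq> v \<longrightarrow>
            ((u, v) \<in> parcs G \<longleftrightarrow> hyp_dist (p u) (p v) \<le> 2 * \<rho>)))"


section \<open>Graph parameters\<close>

definition clique_number :: "'a pair_pre_digraph \<Rightarrow> nat" where
  "clique_number G = Max {k. \<exists>K. subgraph K (with_proj G) \<and> complete_digraph k K}"

text \<open>
  The constant \<^const>\<open>tree\<close> forbids every directed closed walk without repeated vertices, hence
  also the walk \<open>u, v, u\<close> along a single undirected edge. Cycles of an undirected graph are those
  of length at least 3.
\<close>

definition undirected_tree :: "'a pair_pre_digraph \<Rightarrow> bool" where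
  "undirected_tree T \<longleftrightarrow> pair_graph T \<and> Digraph_Component.connected (with_proj T) \<and>
    \<not> (\<exists>c. pre_digraph.cycle (with_proj T) c \<and> 3 \<le> length c)"

definition tree_decomposition ::
    "'a pair_pre_digraph \<Rightarrow> 't pair_pre_digraph \<Rightarrow> ('t \<Rightarrow> 'a set) \<Rightarrow> bool" where
  "tree_decomposition G T B \<longleftrightarrow> undirected_tree T \<and>
    (\<Union>t\<in>pverts T. B t) = pverts G \<and>
    (\<forall>(u, v)\<in>parcs G. \<exists>t\<in>pverts T. u \<in> B t \<and> v \<in> B t) \<and>
    (\<forall>v\<in>pverts G. Digraph_Component.connected (with_proj T \<restriction> {t \<in> pverts T. v \<in> B t}))"

text \<open>By truncated subtraction, the graph without vertices gets treewidth 0 rather than \<open>-1\<close>.\<close>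

definition decomposition_width :: "'t pair_pre_digraph \<Rightarrow> ('t \<Rightarrow> 'a set) \<Rightarrow> nat" where
  "decomposition_width T B = Max ((\<lambda>t. card (B t)) ` pverts T) - 1"

text \<open>Every finite tree is isomorphic to one whose nodes are natural numbers.\<close>

definition treewidth :: "'a pair_pre_digraph \<Rightarrow> nat" where
  "treewidth G = (LEAST k. \<exists>(T :: nat pair_pre_digraph) B.
      tree_decomposition G T B \<and> decomposition_width T B = k)"

definition strong_product ::
    "'a pair_pre_digraph \<Rightarrow> 'b pair_pre_digraph \<Rightarrow> ('a \<times> 'b) pair_pre_digraph"
    (infixr \<open>\<boxtimes>\<close> 70) where
  "G \<boxtimes> H = \<lparr>pverts = pverts G \<times> pverts H,
    parcs = {((u, u'), (v, v')).
      (u, u') \<in> pverts G \<times> pverts H \<and> (v, v') \<in> pverts G \<times> pverts H \<and>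
      (u, u') \<noteq> (v, v') \<and>
      (u = v \<or> (u, v) \<in> parcs G) \<and> (u' = v' \<or> (u', v') \<in> parcs H)}\<rparr>"

definition path_graph :: "nat \<Rightarrow> nat pair_pre_digraph" where
  "path_graph m = \<lparr>pverts = {..<m},
    parcs = {(i, j). i < m \<and> j < m \<and> (j = Suc i \<or> i = Suc j)}\<rparr>"

definition embeds :: "'a pair_pre_digraph \<Rightarrow> 'b pair_pre_digraph \<Rightarrow> bool" where
  "embeds G H \<longleftrightarrow> (\<exists>G'. digraph_iso (with_proj G) G' \<and> subgraph G' (with_proj H))"

text \<open>
  Up to isomorphism, \<open>H\<close> has natural numbers as vertices, and the paths are the graphs
  \<open>path_graph m\<close> with \<open>m \<ge> 1\<close>.
\<close>

definition row_treewidth :: "'a pair_pre_digraph \<Rightarrow> nat" where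
  "row_treewidth G = (LEAST t. \<exists>(H :: nat pair_pre_digraph) m.
      pair_graph H \<and> treewidth H = t \<and> 1 \<le> m \<and> embeds G (H \<boxtimes> path_graph m))"


section \<open>Asymptotics over a family of graphs\<close>

definition num_verts :: "'a pair_pre_digraph \<Rightarrow> nat" where
  "num_verts G = card (pverts G)"

text \<open>The filter of the members of a family whose number of vertices tends to infinity.\<close>

definition large_members :: "'a pair_pre_digraph set \<Rightarrow> 'a pair_pre_digraph filter" where
  "large_members F = inf (filtercomap num_verts at_top) (principal F)"

lemma eventually_large_members:
  "eventually P (large_members F) \<longleftrightarrow> (\<exists>N. \<forall>G\<in>F. N \<le> num_verts G \<longrightarrow> P G)"
  unfolding large_members_def eventually_inf_principal eventually_filtercomap
    eventually_at_top_linorder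
  by fast

definition hudg_family :: "'a pair_pre_digraph set \<Rightarrow> (nat \<Rightarrow> real) \<Rightarrow> bool" where
  "hudg_family F r \<longleftrightarrow> (\<forall>N. \<exists>G\<in>F. N \<le> num_verts G) \<and>
    (\<exists>\<rho>. (\<forall>G\<in>F. hudg (\<rho> G) G) \<and> \<rho> \<in> \<Theta>[large_members F](\<lambda>G. r (num_verts G)))"

end

theory Submission
  imports Defs "HOL-Real_Asymp.Real_Asymp"
begin

text \<open>
  In the upper half-plane, points of heights \<open>s\<close> and \<open>t\<close> at horizontal distance \<open>d\<close> are at hyperbolic
  distance at most \<open>2 * \<rho>\<close> iff \<open>d\<^sup>2 + (s - t)\<^sup>2 \<le> K\<^sup>2 * s * t\<close> with \<open>K = 2 * sinh \<rho>\<close>. Once horizontal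
  distances are measured in units of \<open>K\<close>, this says \<open>d \<le> sqrt (s * t)\<close> up to a correction that is
  harmless as long as all heights lie between \<open>1\<close> and about \<open>K\<^sup>2\<close>. So a number of scales
  proportional to \<open>\<rho>\<close> fits into one disk. The construction uses points of height \<open>4 ^ a\<close> on level \<open>a\<close>, placed at
  the abscissae \<open>(m + 1/2) * 4 ^ a\<close>: neighbours within a level are just adjacent, and points of levels
  \<open>a\<close> and \<open>b\<close> are adjacent only if their distance is at most \<open>2 ^ (a + b)\<close>.

  Large row-treewidth. Let \<open>D\<close> be proportional to \<open>r n\<close>, and choose a set \<open>A\<close> of levels below \<open>D\<close>. On each level
  of \<open>A\<close>, and on level \<open>D\<close>, take a row of consecutive points, all rows spanning the same interval,
  which has room for \<open>D\<close> points of level \<open>D\<close>. The row of a level in \<open>A\<close> is a path, and every point of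
  level \<open>D\<close> is adjacent to some point of each row below it. Contracting the rows hence yields a complete
  bipartite graph with sides of size at least \<open>card A\<close>, and a bramble argument forces a bag of size
  \<open>card A\<close>. One further point of level \<open>4 * D\<close> dominates all of this, so an embedding into
  \<open>H \<boxtimes> P\<close> uses only three vertices of the path \<open>P\<close>, and a tree decomposition of \<open>H\<close> pulls back to one
  of the core with bags at most three times as large (\<open>row_treewidth_ge\<close>). The treewidth is
  at least the row-treewidth, because one may take \<open>P\<close> to be a single vertex.

  Small cliques. Two points of the same level are adjacent only if consecutive, so a clique has at
  most two points per level. The shift by one half makes points of levels \<open>j < k\<close> differ by at least
  \<open>4 ^ j / 2\<close> horizontally. If both are adjacent to a point of a lower level \<open>i\<close>, the
  triangle inequality gives \<open>2 * j \<le> i + k + 1\<close>: the gaps above the lowest level of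
  a clique essentially double (\<open>near_level_gap\<close>). Taking all levels below \<open>D\<close> therefore gives
  row-treewidth at least of order \<open>D\<close> with cliques of order at most \<open>log D\<close>. The levels
  \<open>D - 2 ^ m\<close> accumulate at the top in such a way that doubling gaps occur only a bounded
  number of times; they give row-treewidth at least of order \<open>log D\<close> with cliques of bounded size.

  The core has at most \<open>64 ^ D\<close> points. As \<open>r n\<close> is at most a constant times \<open>ln n\<close>, this is at
  most \<open>n\<close> when the ratio of \<open>D\<close> and \<open>r n\<close> is a small constant, and further points of level \<open>0\<close> bring
  the number of vertices to exactly \<open>n\<close> without affecting the clique bound.
\<close>

section \<open>Subtrees of a tree\<close>

definition connected_in :: "'a rel \<Rightarrow> 'a set \<Rightarrow> bool" where
  "connected_in E S \<longleftrightarrow> (\<forall>u\<in>S. \<forall>v\<in>S. (u, v) \<in> (E \<inter> S \<times> S)\<^sup>*)"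

text \<open>
  A cycle is encoded by its list of distinct vertices; the closing edge leads from the last vertex back
  to the first. Length at least 3 excludes the two orientations of a single edge.
\<close>

definition no_cycle :: "'a rel \<Rightarrow> bool" where
  "no_cycle E \<longleftrightarrow>
    (\<forall>p. distinct p \<and> 3 \<le> length p \<and> successively (\<lambda>x y. (x, y) \<in> E) p \<longrightarrow> (last p, hd p) \<notin> E)"

lemma rtrancl_obtain_path:
  assumes "(u, v) \<in> R\<^sup>*"
  obtains p where "p \<noteq> []" "hd p = u" "last p = v" "distinct p" "successively (\<lambda>x y. (x, y) \<in> R) p"
proof -
  have "\<exists>p. p \<noteq> [] \<and> hd p = u \<and> last p = v \<and> distinct p \<and> successively (\<lambda>x y. (x, y) \<in> R) p"
    using assms
  proof (induction rule: rtrancl_induct)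
    case base
    show ?case by (rule exI[of _ "[u]"]) auto
  next
    case (step v w)
    then obtain p where p: "p \<noteq> []" "hd p = u" "last p = v" "distinct p"
      "successively (\<lambda>x y. (x, y) \<in> R) p" by blast
    show ?case
    proof (cases "w \<in> set p")
      case True
      then obtain xs ys where p_eq: "p = xs @ w # ys" by (auto simp: in_set_conv_decomp)
      show ?thesis
        using p unfolding p_eq
        by (intro exI[of _ "xs @ [w]"]) (auto simp: successively_append_iff hd_append)
    next
      case False
      then show ?thesis
        using p step.hyps
        by (intro exI[of _ "p @ [w]"]) (auto simp: successively_append_iff)
    qed
  qed
  then show ?thesis using that by blast
qed

lemma path_imp_rtrancl:
  assumes "successively (\<lambda>x y. (x, y) \<in> R) p" "p \<noteq> []"
  shows "(hd p, last p) \<in> R\<^sup>*"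
  using assms
  by (induction p rule: induct_list012) (auto intro: converse_rtrancl_into_rtrancl)

text \<open>
  If \<open>w\<close> could be reached from \<open>u\<close> avoiding \<open>t\<close> and from \<open>t\<close> avoiding \<open>u\<close>, the second walk
  would leave \<open>t\<close> through a neighbour other than \<open>u\<close>, and both walks together would connect that
  neighbour to \<open>u\<close> outside of \<open>t\<close>: a cycle through \<open>t\<close>.
\<close>

lemma sides_of_tree_edge_disjoint:
  assumes sym: "sym E" and nc: "no_cycle E" and tu: "(t, u) \<in> E" "t \<noteq> u"
    and uw: "(u, w) \<in> (E \<inter> (-{t}) \<times> (-{t}))\<^sup>*"
    and tw: "(t, w) \<in> (E \<inter> (-{u}) \<times> (-{u}))\<^sup>*"
  shows False
proof -
  let ?Rt = "E \<inter> (-{t}) \<times> (-{t})"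
  have "w \<noteq> t"
    using uw tu(2) by (auto elim: rtranclE)
  obtain p where p: "p \<noteq> []" "hd p = t" "last p = w" "distinct p"
    "successively (\<lambda>x y. (x, y) \<in> E \<inter> (-{u}) \<times> (-{u})) p"
    using rtrancl_obtain_path[OF tw] by blast
  then obtain q where q: "p = t # q" by (cases p) auto
  have "q \<noteq> []" using p q \<open>w \<noteq> t\<close> by auto
  have y: "(t, hd q) \<in> E" "hd q \<noteq> u" "hd q \<noteq> t"
    using p \<open>q \<noteq> []\<close> unfolding q by (auto simp: successively_Cons)
  have "successively (\<lambda>x y. (x, y) \<in> ?Rt) q"
    using p unfolding q successively_conv_nth by (auto simp: successively_Cons successively_conv_nth in_set_conv_nth)
  with \<open>q \<noteq> []\<close> p(3) q have "(hd q, w) \<in> ?Rt\<^sup>*"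
    using path_imp_rtrancl[of ?Rt q] by simp
  moreover have "(w, u) \<in> ?Rt\<^sup>*"
  proof -
    have "sym ?Rt" using sym by (auto simp: sym_def)
    with uw show ?thesis by (meson sym_rtrancl symD)
  qed
  ultimately have "(hd q, u) \<in> ?Rt\<^sup>*" by (rule rtrancl_trans)
  then obtain s where s: "s \<noteq> []" "hd s = hd q" "last s = u" "distinct s"
    "successively (\<lambda>x y. (x, y) \<in> ?Rt) s"
    using rtrancl_obtain_path by metis
  have "length s \<noteq> 1"
    using s y(2) by (auto simp: length_Suc_conv)
  moreover have "length s \<noteq> 0" using s(1) by simp
  ultimately have len: "3 \<le> length (t # s)" by (cases s rule: remdups_adj.cases) auto
  have "t \<notin> set s"
  proof
    assume "t \<in> set s"
    then obtain xs ys where dec: "s = xs @ t # ys" by (auto simp: in_set_conv_decomp)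
    show False
      using s(2,5) y(3) unfolding dec
      by (cases xs rule: rev_cases) (auto simp: successively_append_iff)
  qed
  moreover have "successively (\<lambda>x y. (x, y) \<in> E) (t # s)"
    using s y(1) by (auto simp: successively_Cons intro: successively_mono)
  moreover have "(last (t # s), hd (t # s)) \<in> E"
    using s(1,3) tu(1) sym by (auto dest: symD)
  ultimately show False
    using nc len s(4) unfolding no_cycle_def by (metis distinct.simps(2))
qed

text \<open>
  A connected set that misses \<open>t\<close> lies in a single component of the graph without \<open>t\<close>; the first edge of
  a path from \<open>t\<close> to the set points to that component.
\<close>

lemma connected_in_side:
  assumes conn: "connected_in E V" and EV: "E \<subseteq> V \<times> V" and t: "t \<in> V"
    and S: "S \<subseteq> V" "S \<noteq> {}" "connected_in E S" "t \<notin> S"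
  obtains u where "(t, u) \<in> E" "\<And>s. s \<in> S \<Longrightarrow> (u, s) \<in> (E \<inter> (-{t}) \<times> (-{t}))\<^sup>*"
proof -
  let ?Rt = "E \<inter> (-{t}) \<times> (-{t})"
  obtain s where s: "s \<in> S" using S(2) by blast
  have "(t, s) \<in> (E \<inter> V \<times> V)\<^sup>*" using conn t s S(1) unfolding connected_in_def by blast
  then obtain p where p: "p \<noteq> []" "hd p = t" "last p = s" "distinct p"
    "successively (\<lambda>x y. (x, y) \<in> E \<inter> V \<times> V) p"
    using rtrancl_obtain_path by metis
  then obtain q where q: "p = t # q" by (cases p) auto
  have "q \<noteq> []" using p q s S(4) by auto
  have y: "(t, hd q) \<in> E"
    using p \<open>q \<noteq> []\<close> unfolding q by (auto simp: successively_Cons)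
  have "successively (\<lambda>x y. (x, y) \<in> ?Rt) q"
    using p unfolding q successively_conv_nth by (auto simp: successively_Cons successively_conv_nth in_set_conv_nth)
  with \<open>q \<noteq> []\<close> p(3) q have qs: "(hd q, s) \<in> ?Rt\<^sup>*"
    using path_imp_rtrancl[of ?Rt q] by simp
  have "(hd q, s') \<in> ?Rt\<^sup>*" if "s' \<in> S" for s'
  proof -
    have "(s, s') \<in> (E \<inter> S \<times> S)\<^sup>*" using S(3) s that unfolding connected_in_def by blast
    moreover have "E \<inter> S \<times> S \<subseteq> ?Rt" using S(4) by blast
    ultimately have "(s, s') \<in> ?Rt\<^sup>*" using rtrancl_mono by blast
    with qs show ?thesis by (rule rtrancl_trans)
  qed
  with y show ?thesis using that by blast
qed

text \<open>
  Following \<open>f\<close> without ever turning back would be a non-backtracking walk, which in an acyclic graph never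
  revisits a vertex and so cannot continue forever in a finite one.
\<close>

lemma neighbour_map_has_2_cycle:
  assumes fin: "finite V" and v: "v \<in> V" and EV: "E \<subseteq> V \<times> V" and irr: "irrefl E"
    and nc: "no_cycle E"
    and f: "\<And>t. t \<in> V \<Longrightarrow> (t, f t) \<in> E"
  obtains t where "t \<in> V" "f (f t) = t"
proof -
  have "\<exists>t\<in>V. f (f t) = t"
  proof (rule ccontr)
    assume no: "\<not> ?thesis"
    define w where "w i = (f ^^ i) v" for i
    have wS: "w (Suc i) = f (w i)" for i by (simp add: w_def)
    have wV: "w i \<in> V" for i
    proof (induction i)
      case 0
      show ?case using v by (simp add: w_def)
    next
      case (Suc i)
      then show ?case using f EV wS by (metis SigmaD2 subsetD)
    qed
    have edge: "(w i, w (Suc i)) \<in> E" for i using f[OF wV] wS by simp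
    have dist: "distinct (map w [0..<n])" for n
    proof (induction n)
      case (Suc n)
      have "w n \<noteq> w i" if "i < n" for i
      proof
        assume eq: "w n = w i"
        let ?p = "map w [i..<n]"
        have "n \<noteq> Suc i" using edge[of i] irr eq by (auto simp: irrefl_def)
        moreover have "n \<noteq> Suc (Suc i)" using no wV[of i] wS eq by metis
        ultimately have len: "3 \<le> length ?p" using that by auto
        have "distinct ?p"
          using Suc that by (auto simp: distinct_map inj_on_def)
        moreover have "successively (\<lambda>x y. (x, y) \<in> E) ?p"
          using edge by (auto simp: successively_conv_nth)
        moreover have "(last ?p, hd ?p) \<in> E"
        proof -
          have "last ?p = w (n - 1)" "hd ?p = w n"
            using that eq by (auto simp: last_map hd_map)
          then show ?thesis using edge[of "n - 1"] that by simp
        qed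
        ultimately show False using nc len unfolding no_cycle_def by blast
      qed
      with Suc show ?case by force
    qed simp
    have "Suc (card V) = card (set (map w [0..<Suc (card V)]))"
      using distinct_card[OF dist[of "Suc (card V)"]] by simp
    also have "\<dots> \<le> card V" using wV by (intro card_mono fin) auto
    finally show False by simp
  qed
  then show ?thesis using that by blast
qed

text \<open>
  The Helly property of subtrees. If no vertex were common to all of them, each vertex \<open>t\<close> would be
  missed by some subtree and could be directed towards it. Two adjacent vertices are then
  directed towards each other, and the two subtrees lie on opposite sides of that edge, so they are disjoint.
\<close>

lemma subtrees_Helly:
  assumes fin: "finite V" "V \<noteq> {}" and EV: "E \<subseteq> V \<times> V" and sym: "sym E" and irr: "irrefl E"
    and nc: "no_cycle E" and conn: "connected_in E V"
    and sub: "\<And>S. S \<in> \<S> \<Longrightarrow> S \<subseteq> V \<and> connected_in E S"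
    and meet: "\<And>S S'. S \<in> \<S> \<Longrightarrow> S' \<in> \<S> \<Longrightarrow> S \<inter> S' \<noteq> {}"
  obtains t where "t \<in> V" "\<And>S. S \<in> \<S> \<Longrightarrow> t \<in> S"
proof -
  have "\<exists>t\<in>V. \<forall>S\<in>\<S>. t \<in> S"
  proof (rule ccontr)
    assume "\<not> ?thesis"
    then have "\<forall>t\<in>V. \<exists>S. S \<in> \<S> \<and> t \<notin> S" by blast
    then obtain X where X: "\<And>t. t \<in> V \<Longrightarrow> X t \<in> \<S> \<and> t \<notin> X t" by metis
    have "\<exists>u. (t, u) \<in> E \<and> (\<forall>s\<in>X t. (u, s) \<in> (E \<inter> (-{t}) \<times> (-{t}))\<^sup>*)" if t: "t \<in> V" for t
    proof -
      have "X t \<subseteq> V" "connected_in E (X t)" using sub X t by auto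
      moreover have "X t \<noteq> {}" using meet X t by blast
      moreover have "t \<notin> X t" using X t by blast
      ultimately show ?thesis
        using connected_in_side[OF conn EV t] by metis
    qed
    then obtain f where f: "\<And>t. t \<in> V \<Longrightarrow> (t, f t) \<in> E"
      "\<And>t s. t \<in> V \<Longrightarrow> s \<in> X t \<Longrightarrow> (f t, s) \<in> (E \<inter> (-{t}) \<times> (-{t}))\<^sup>*"
      by metis
    obtain v where v: "v \<in> V" using fin(2) by blast
    obtain t where t: "t \<in> V" "f (f t) = t"
      using neighbour_map_has_2_cycle[OF fin(1) v EV irr nc, of f] f(1) by blast
    have ft: "f t \<in> V" using f(1) t(1) EV by blast
    obtain w where w: "w \<in> X t" "w \<in> X (f t)" using meet X t(1) ft by blast
    have "t \<noteq> f t" using f(1)[OF t(1)] irr by (auto simp: irrefl_def)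
    then show False
      using sides_of_tree_edge_disjoint[OF sym nc f(1)[OF t(1)] _ f(2)[OF t(1) w(1)]]
        f(2)[OF ft w(2)] t(2) by simp
  qed
  then show ?thesis using that by blast
qed

lemma connected_in_UN:
  assumes X: "connected_in R X"
    and F: "\<And>x. x \<in> X \<Longrightarrow> connected_in E (F x) \<and> F x \<noteq> {}"
    and adj: "\<And>x y. (x, y) \<in> R \<Longrightarrow> x \<in> X \<Longrightarrow> y \<in> X \<Longrightarrow> F x \<inter> F y \<noteq> {}"
  shows "connected_in E (\<Union>x\<in>X. F x)"
proof -
  let ?U = "\<Union>x\<in>X. F x"
  have within: "(s, t) \<in> (E \<inter> ?U \<times> ?U)\<^sup>*" if "x \<in> X" "s \<in> F x" "t \<in> F x" for x s t
  proof -
    have "(s, t) \<in> (E \<inter> F x \<times> F x)\<^sup>*" using F that unfolding connected_in_def by blast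
    moreover have "E \<inter> F x \<times> F x \<subseteq> E \<inter> ?U \<times> ?U" using that by blast
    ultimately show ?thesis using rtrancl_mono by blast
  qed
  have "(s, t) \<in> (E \<inter> ?U \<times> ?U)\<^sup>*" if x: "x \<in> X" "s \<in> F x" and y: "y \<in> X" "t \<in> F y" for x s y t
  proof -
    have "(x, y) \<in> (R \<inter> X \<times> X)\<^sup>*" using X x y unfolding connected_in_def by blast
    then show ?thesis using y(2)
    proof (induction arbitrary: t rule: rtrancl_induct)
      case base
      then show ?case using within x by blast
    next
      case (step y z)
      then obtain t' where "t' \<in> F y" "t' \<in> F z" using adj by blast
      moreover have "z \<in> X" using step.hyps by blast
      ultimately show ?case
        using step.IH[of t'] within[of z t' t] step.prems by (meson rtrancl_trans)
    qed
  qed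
  then show ?thesis unfolding connected_in_def by blast
qed

text \<open>Passing to the symmetric closure changes nothing here, because \<open>T\<close> is symmetric already.\<close>

lemma connected_induced_imp_connected_in:
  assumes T: "pair_graph T" and con: "Digraph_Component.connected (with_proj T \<restriction> S)"
  shows "connected_in (parcs T) S" "S \<noteq> {}"
proof -
  interpret pair_graph T by (rule T)
  have E: "parcs (mk_symmetric (with_proj T \<restriction> S)) = parcs T \<inter> S \<times> S"
    by (auto simp: parcs_mk_symmetric intro: arcs_symmetric)
  show "S \<noteq> {}" using con by (auto simp: connected_def strongly_connected_def)
  show "connected_in (parcs T) S"
    unfolding connected_in_def
  proof (intro ballI)
    fix u v assume "u \<in> S" "v \<in> S"
    then have "(u, v) \<in> rtrancl_on S (parcs T \<inter> S \<times> S)"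
      using con E by (auto simp: connected_def strongly_connected_def reachable_def)
    then show "(u, v) \<in> (parcs T \<inter> S \<times> S)\<^sup>*" by (rule rtrancl_on_rtranclI)
  qed
qed

text \<open>
  A walk given by its list \<open>q\<close> of vertices has the list \<open>zip q (tl q)\<close> of arcs.
\<close>

lemma pcas_zip:
  assumes "q \<noteq> []" shows "pcas (hd q) (zip q (tl q)) (last q)"
  using assms by (induction q rule: induct_list012) auto

lemma pawalk_verts_zip:
  assumes "q \<noteq> []" shows "pawalk_verts (hd q) (zip q (tl q)) = q"
  using assms by (induction q rule: induct_list012) auto

lemma undirected_tree_no_cycle:
  assumes T: "undirected_tree T"
  shows "no_cycle (parcs T)"
  unfolding no_cycle_def
proof (intro allI impI notI, elim conjE)
  fix p assume p: "distinct p" "3 \<le> length p" "successively (\<lambda>x y. (x, y) \<in> parcs T) p"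
    and closing: "(last p, hd p) \<in> parcs T"
  interpret pair_graph T using T by (simp add: undirected_tree_def)
  define q where "q = p @ [hd p]"
  define c where "c = zip q (tl q)"
  have ne: "p \<noteq> []" using p(2) by auto
  have "successively (\<lambda>x y. (x, y) \<in> parcs T) q"
    using p closing ne by (auto simp: q_def successively_append_iff)
  then have arcs: "set c \<subseteq> parcs T"
    by (auto simp: c_def set_zip successively_conv_nth nth_tl)
  have hdq: "hd q = hd p" "last q = hd p" "q \<noteq> []" using ne by (auto simp: q_def)
  have "hd p \<in> pverts T" using closing by (rule in_arcsD2)
  then have "awalk (hd p) c (hd p)"
    using arcs pcas_zip[OF hdq(3)] hdq by (simp add: awalk_def c_def)
  moreover have "pawalk_verts (hd p) c = q"
    using pawalk_verts_zip[OF hdq(3)] hdq by (simp add: c_def)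
  moreover have "distinct (tl q)"
    using p(1) ne by (cases p) (auto simp: q_def)
  moreover have len: "length c = length p" using ne by (simp add: c_def q_def)
  ultimately have "pre_digraph.cycle (with_proj T) c"
    using ne unfolding cycle_def by (intro exI[of _ "hd p"]) auto
  with len p(2) show False using T by (metis undirected_tree_def)
qed

lemma undirected_tree_connected_in:
  assumes T: "undirected_tree T"
  shows "connected_in (parcs T) (pverts T)" "pverts T \<noteq> {}"
proof -
  interpret pair_graph T using T by (simp add: undirected_tree_def)
  have "with_proj T \<restriction> pverts T = with_proj T"
    by (auto simp: induce_subgraph_def with_proj_def dest: in_arcsD1 in_arcsD2)
  then show "connected_in (parcs T) (pverts T)" "pverts T \<noteq> {}"
    using connected_induced_imp_connected_in[of T "pverts T"] T by (auto simp: undirected_tree_def)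
qed

section \<open>A lower bound for the row-treewidth\<close>

text \<open>
  Treewidth and row-treewidth are defined as least elements; bounding them requires that the
  respective sets are inhabited.
\<close>

lemma single_bag_decomposition:
  fixes G :: "'a pair_pre_digraph"
  assumes G: "pair_graph G"
  shows "\<exists>(T :: nat pair_pre_digraph) B. tree_decomposition G T B"
proof -
  interpret pair_graph G by (rule G)
  define T :: "nat pair_pre_digraph" where "T = \<lparr>pverts = {0}, parcs = {}\<rparr>"
  interpret T: pair_graph T
    by unfold_locales (auto simp: T_def symmetric_def sym_def)
  have conn: "Digraph_Component.connected (with_proj T \<restriction> {0})"
    by (auto simp: connected_def strongly_connected_def parcs_mk_symmetric T_def reachable_def)
  have "with_proj T \<restriction> {0} = with_proj T"
    by (auto simp: induce_subgraph_def with_proj_def T_def)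
  moreover have "c = []" if "T.awalk u c v" for u c v
    using that by (auto simp: T.awalk_def) (simp add: T_def)
  ultimately have "undirected_tree T"
    using conn T.pair_graph by (auto simp: undirected_tree_def T.cycle_def)
  then have "tree_decomposition G T (\<lambda>_. pverts G)"
    using conn by (auto simp: tree_decomposition_def T_def dest: in_arcsD1 in_arcsD2)
  then show ?thesis by blast
qed

lemma treewidth_attained:
  fixes G :: "'a pair_pre_digraph"
  assumes "pair_graph G"
  obtains T :: "nat pair_pre_digraph" and B
  where "tree_decomposition G T B" "decomposition_width T B = treewidth G"
proof -
  have "\<exists>k (T :: nat pair_pre_digraph) B. tree_decomposition G T B \<and> decomposition_width T B = k"
    using single_bag_decomposition[OF assms] by blast
  then have "\<exists>(T :: nat pair_pre_digraph) B.
      tree_decomposition G T B \<and> decomposition_width T B = treewidth G"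
    unfolding treewidth_def by (rule LeastI_ex)
  then show ?thesis using that by blast
qed

lemma embeds_strong_product_one_vertex_path:
  assumes G: "pair_graph G"
  shows "embeds G (G \<boxtimes> path_graph 1)"
proof -
  interpret pair_graph G by (rule G)
  define h :: "('a, 'a \<times> 'a, 'a \<times> nat, ('a \<times> nat) \<times> ('a \<times> nat)) digraph_isomorphism" where
    "h = \<lparr>iso_verts = (\<lambda>v. (v, 0)), iso_arcs = (\<lambda>(u, v). ((u, 0), (v, 0))),
      iso_head = snd, iso_tail = fst\<rparr>"
  have iso: "digraph_isomorphism h"
    by (auto simp: digraph_isomorphism_def h_def inj_on_def intro: wf_digraph_axioms)
  have wf: "wf_digraph (app_iso h (with_proj G))"
    using iso by (rule wf_digraphI_app_iso)
  have "pair_wf_digraph (G \<boxtimes> path_graph 1)"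
    by unfold_locales (auto simp: strong_product_def)
  then have "subgraph (app_iso h (with_proj G)) (with_proj (G \<boxtimes> path_graph 1))"
    using wf by (auto simp: subgraph_def compatible_def wf_digraph_wp_iff h_def
        strong_product_def path_graph_def dest: in_arcsD1 in_arcsD2 no_loops')
  then show ?thesis
    using iso unfolding embeds_def digraph_iso_def by blast
qed

lemma row_treewidth_le_treewidth:
  fixes G :: "nat pair_pre_digraph"
  assumes "pair_graph G"
  shows "row_treewidth G \<le> treewidth G"
  unfolding row_treewidth_def
  using assms embeds_strong_product_one_vertex_path[OF assms]
  by (intro Least_le exI[of _ G] exI[of _ "1::nat"]) auto

lemma row_treewidth_attained:
  fixes G :: "nat pair_pre_digraph"
  assumes "pair_graph G"
  obtains H :: "nat pair_pre_digraph" and m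
  where "pair_graph H" "treewidth H = row_treewidth G" "embeds G (H \<boxtimes> path_graph m)"
proof -
  have "\<exists>t (H :: nat pair_pre_digraph) m.
      pair_graph H \<and> treewidth H = t \<and> 1 \<le> m \<and> embeds G (H \<boxtimes> path_graph m)"
    using assms embeds_strong_product_one_vertex_path[OF assms] by (meson order_refl)
  then have "\<exists>(H :: nat pair_pre_digraph) m. pair_graph H \<and> treewidth H = row_treewidth G \<and>
      1 \<le> m \<and> embeds G (H \<boxtimes> path_graph m)"
    unfolding row_treewidth_def by (rule LeastI_ex)
  then show ?thesis using that by blast
qed

lemma embedsE:
  assumes "embeds G H"
  obtains \<phi> where "inj_on \<phi> (pverts G)" "\<phi> ` pverts G \<subseteq> pverts H"
    "\<And>u v. (u, v) \<in> parcs G \<Longrightarrow> (\<phi> u, \<phi> v) \<in> parcs H"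
proof -
  obtain h where h: "pre_digraph.digraph_isomorphism (with_proj G) h"
    and sub: "subgraph (app_iso h (with_proj G)) (with_proj H)"
    using assms unfolding embeds_def digraph_iso_def by blast
  have "(iso_verts h u, iso_verts h v) \<in> parcs H" if "(u, v) \<in> parcs G" for u v
  proof -
    have "iso_arcs h (u, v) \<in> parcs H" using sub that by (auto simp: subgraph_def)
    moreover have "fst (iso_arcs h (u, v)) = iso_verts h u" "snd (iso_arcs h (u, v)) = iso_verts h v"
      using h sub that by (auto simp: pre_digraph.digraph_isomorphism_def subgraph_def compatible_def)
    ultimately show ?thesis by (metis prod.collapse)
  qed
  moreover have "inj_on (iso_verts h) (pverts G)"
    using h by (simp add: pre_digraph.digraph_isomorphism_def)
  moreover have "iso_verts h ` pverts G \<subseteq> pverts H"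
    using sub by (auto simp: subgraph_def)
  ultimately show ?thesis using that by blast
qed

text \<open>
  The easy half of the duality between treewidth and brambles: the nodes whose bags meet a connected
  set form a subtree, touching sets have intersecting subtrees, and a node common to all
  subtrees exists by the Helly property. The bags need only decompose the part of the graph induced by \<open>U\<close>.
\<close>

lemma bag_meets_touching_sets:
  assumes T: "undirected_tree T"
    and bags: "\<And>u. u \<in> U \<Longrightarrow> connected_in (parcs T) {t \<in> pverts T. u \<in> B t} \<and>
      {t \<in> pverts T. u \<in> B t} \<noteq> {}"
    and edges: "\<And>u v. (u, v) \<in> E \<Longrightarrow> u \<in> U \<Longrightarrow> v \<in> U \<Longrightarrow> \<exists>t\<in>pverts T. u \<in> B t \<and> v \<in> B t"
    and sets: "\<And>X. X \<in> \<X> \<Longrightarrow> X \<subseteq> U \<and> connected_in E X"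
    and touch: "\<And>X Y. X \<in> \<X> \<Longrightarrow> Y \<in> \<X> \<Longrightarrow> X \<inter> Y \<noteq> {} \<or> (\<exists>x\<in>X. \<exists>y\<in>Y. (x, y) \<in> E)"
  obtains t where "t \<in> pverts T" "\<And>X. X \<in> \<X> \<Longrightarrow> X \<inter> B t \<noteq> {}"
proof -
  interpret T: pair_graph T using T by (simp add: undirected_tree_def)
  define F where "F u = {t \<in> pverts T. u \<in> B t}" for u
  \<comment> \<open>The subtree of nodes whose bags meet \<open>X\<close> is the union of the subtrees of its vertices.\<close>
  define \<S> where "\<S> = (\<lambda>X. \<Union>u\<in>X. F u) ` \<X>"
  have sub: "S \<subseteq> pverts T \<and> connected_in (parcs T) S" if S: "S \<in> \<S>" for S
  proof -
    obtain X where X: "X \<in> \<X>" and S_eq: "S = (\<Union>u\<in>X. F u)" using S by (auto simp: \<S>_def)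
    have XU: "X \<subseteq> U" using sets[OF X] by simp
    have "connected_in (parcs T) S"
      unfolding S_eq
    proof (rule connected_in_UN)
      show "connected_in E X" using sets[OF X] by simp
      show "connected_in (parcs T) (F u) \<and> F u \<noteq> {}" if "u \<in> X" for u
        using bags[of u] that XU unfolding F_def by blast
      show "F u \<inter> F v \<noteq> {}" if "(u, v) \<in> E" "u \<in> X" "v \<in> X" for u v
        using edges[of u v] that XU unfolding F_def by blast
    qed
    then show ?thesis by (auto simp: S_eq F_def)
  qed
  have meet: "S \<inter> S' \<noteq> {}" if S: "S \<in> \<S>" "S' \<in> \<S>" for S S'
  proof -
    obtain X Y where XY: "X \<in> \<X>" "Y \<in> \<X>" and S_eq: "S = (\<Union>u\<in>X. F u)" "S' = (\<Union>u\<in>Y. F u)"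
      using S by (auto simp: \<S>_def)
    have XU: "X \<subseteq> U" "Y \<subseteq> U" using sets XY by auto
    from touch[OF XY] obtain x y where xy: "x \<in> X" "y \<in> Y" "x = y \<or> (x, y) \<in> E" by blast
    then have "F x \<inter> F y \<noteq> {}"
      using bags[of x] edges[of x y] XU unfolding F_def by blast
    with xy show ?thesis by (auto simp: S_eq)
  qed
  have arcs: "parcs T \<subseteq> pverts T \<times> pverts T" "sym (parcs T)" "irrefl (parcs T)"
    using T.in_arcsD1 T.in_arcsD2 T.arcs_symmetric T.no_loops'
    by (auto simp: sym_def irrefl_def) blast
  obtain t where t: "t \<in> pverts T" "\<And>S. S \<in> \<S> \<Longrightarrow> t \<in> S"
    using subtrees_Helly[OF T.pair_finite_verts undirected_tree_connected_in(2)[OF T] arcs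
        undirected_tree_no_cycle[OF T] undirected_tree_connected_in(1)[OF T] sub meet] by metis
  have "X \<inter> B t \<noteq> {}" if "X \<in> \<X>" for X
    using t(2)[of "\<Union>u\<in>X. F u"] that by (auto simp: \<S>_def F_def)
  with t(1) show ?thesis using that by blast
qed

lemma connected_in_insert:
  assumes S: "connected_in E S" and sym: "sym E" and y: "y \<in> S" "(x, y) \<in> E"
  shows "connected_in E (insert x S)"
  unfolding connected_in_def
proof (intro ballI)
  let ?R = "E \<inter> insert x S \<times> insert x S"
  have in_S: "(u, v) \<in> ?R\<^sup>*" if "u \<in> S" "v \<in> S" for u v
  proof -
    have "(u, v) \<in> (E \<inter> S \<times> S)\<^sup>*" using S that unfolding connected_in_def by blast
    moreover have "E \<inter> S \<times> S \<subseteq> ?R" by blast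
    ultimately show ?thesis using rtrancl_mono by blast
  qed
  have xy: "(x, y) \<in> ?R" "(y, x) \<in> ?R" using y sym by (auto dest: symD)
  fix u v assume uv: "u \<in> insert x S" "v \<in> insert x S"
  have "(u, y) \<in> ?R\<^sup>*" using uv(1) in_S y(1) xy(1) by auto
  moreover have "(y, v) \<in> ?R\<^sup>*" using uv(2) in_S y(1) xy(2) by auto
  ultimately show "(u, v) \<in> ?R\<^sup>*" by (rule rtrancl_trans)
qed

text \<open>
  The bramble consists of the sets \<open>insert x (R a)\<close>. They touch pairwise since each \<open>x\<close> has a
  neighbour in every row. A bag meeting all of them meets every row, or else it misses a row and must
  contain every \<open>x\<close>; either way it has at least \<open>card A\<close> elements.
\<close>

lemma bag_large_if_biclique_of_rows:
  assumes T: "undirected_tree T"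
    and bags: "\<And>u. u \<in> U \<Longrightarrow> connected_in (parcs T) {t \<in> pverts T. u \<in> B t} \<and>
      {t \<in> pverts T. u \<in> B t} \<noteq> {}"
    and edges: "\<And>u v. (u, v) \<in> E \<Longrightarrow> u \<in> U \<Longrightarrow> v \<in> U \<Longrightarrow> \<exists>t\<in>pverts T. u \<in> B t \<and> v \<in> B t"
    and fin: "\<And>t. t \<in> pverts T \<Longrightarrow> finite (B t)"
    and sym: "sym E"
    and rows: "\<And>a. a \<in> A \<Longrightarrow> R a \<subseteq> U \<and> connected_in E (R a)"
    and disj: "\<And>a b. a \<in> A \<Longrightarrow> b \<in> A \<Longrightarrow> a \<noteq> b \<Longrightarrow> R a \<inter> R b = {}"
    and X: "X \<subseteq> U" "card A \<le> card X"
    and adj: "\<And>x a. x \<in> X \<Longrightarrow> a \<in> A \<Longrightarrow> \<exists>y\<in>R a. (x, y) \<in> E"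
  obtains t where "t \<in> pverts T" "card A \<le> card (B t)"
proof -
  define \<X> where "\<X> = (\<lambda>(a, x). insert x (R a)) ` (A \<times> X)"
  have sets: "Z \<subseteq> U \<and> connected_in E Z" if Z_in: "Z \<in> \<X>" for Z
  proof -
    obtain a x where ax: "a \<in> A" "x \<in> X" and Z: "Z = insert x (R a)"
      using Z_in by (auto simp: \<X>_def)
    obtain y where "y \<in> R a" "(x, y) \<in> E" using adj[OF ax(2,1)] by blast
    with ax show ?thesis
      unfolding Z using rows[OF ax(1)] X(1) connected_in_insert[OF _ sym] by blast
  qed
  have touch: "Y \<inter> Z \<noteq> {} \<or> (\<exists>y\<in>Y. \<exists>z\<in>Z. (y, z) \<in> E)" if YZ: "Y \<in> \<X>" "Z \<in> \<X>" for Y Z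
  proof -
    obtain a x b z where *: "x \<in> X" "Y = insert x (R a)" "b \<in> A" "Z = insert z (R b)"
      using YZ by (auto simp: \<X>_def)
    then show ?thesis using adj[of x b] by blast
  qed
  obtain t where t: "t \<in> pverts T" "\<And>Z. Z \<in> \<X> \<Longrightarrow> Z \<inter> B t \<noteq> {}"
  proof (rule bag_meets_touching_sets[OF T, where U = U and B = B and E = E and \<X> = \<X>])
    show "Y \<inter> Z \<noteq> {} \<or> (\<exists>y\<in>Y. \<exists>z\<in>Z. (y, z) \<in> E)" if "Y \<in> \<X>" "Z \<in> \<X>" for Y Z
      using touch that by blast
  qed (use bags edges sets in blast)+
  have "card A \<le> card (B t)"
  proof (cases "\<exists>a\<in>A. R a \<inter> B t = {}")
    case True
    then obtain a where a: "a \<in> A" "R a \<inter> B t = {}" by blast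
    have "X \<subseteq> B t"
    proof
      fix x assume "x \<in> X"
      then have "insert x (R a) \<in> \<X>" using a(1) by (auto simp: \<X>_def)
      then show "x \<in> B t" using t(2) a(2) by blast
    qed
    then show ?thesis using X(2) card_mono[OF fin[OF t(1)]] by (meson order_trans)
  next
    case False
    then have "\<forall>a\<in>A. \<exists>y. y \<in> R a \<inter> B t" by blast
    then obtain g where g: "\<And>a. a \<in> A \<Longrightarrow> g a \<in> R a \<inter> B t" by metis
    have "inj_on g A"
    proof (rule inj_onI, rule ccontr)
      fix a b assume "a \<in> A" "b \<in> A" "g a = g b" "a \<noteq> b"
      then show False using g[of a] g[of b] disj[of a b] by auto
    qed
    then show ?thesis
      using g by (intro card_inj_on_le[OF _ _ fin[OF t(1)]]) auto
  qed
  with t(1) show ?thesis using that by blast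
qed

text \<open>
  The vertex \<open>c\<close> confines the path coordinates of \<open>U\<close> to those of \<open>c\<close> and its two neighbours on the path.
  Hence a bag of \<open>H\<close> pulls back to at most three times as many vertices of \<open>U\<close>, and the pulled-back bags
  decompose \<open>U\<close> because vertices adjacent in the product have equal or adjacent \<open>H\<close>-coordinates.
\<close>

lemma row_treewidth_ge:
  fixes G :: "nat pair_pre_digraph"
  assumes G: "pair_graph G"
    and rows: "\<And>a. a \<in> A \<Longrightarrow> R a \<subseteq> U \<and> connected_in (parcs G) (R a)"
    and disj: "\<And>a b. a \<in> A \<Longrightarrow> b \<in> A \<Longrightarrow> a \<noteq> b \<Longrightarrow> R a \<inter> R b = {}"
    and X: "X \<subseteq> U" "card A \<le> card X"
    and adj: "\<And>x a. x \<in> X \<Longrightarrow> a \<in> A \<Longrightarrow> \<exists>y\<in>R a. (x, y) \<in> parcs G"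
    and UG: "U \<subseteq> pverts G"
    and dom: "c \<in> pverts G" "\<And>u. u \<in> U \<Longrightarrow> u = c \<or> (c, u) \<in> parcs G"
  shows "card A \<le> 3 * (row_treewidth G + 1)"
proof -
  interpret pair_graph G by (rule G)
  obtain H :: "nat pair_pre_digraph" and m where H: "pair_graph H"
    and tw: "treewidth H = row_treewidth G" and emb: "embeds G (H \<boxtimes> path_graph m)"
    using row_treewidth_attained[OF G] by metis
  interpret H: pair_graph H by (rule H)
  obtain \<phi> where \<phi>: "inj_on \<phi> (pverts G)" "\<phi> ` pverts G \<subseteq> pverts (H \<boxtimes> path_graph m)"
    "\<And>u v. (u, v) \<in> parcs G \<Longrightarrow> (\<phi> u, \<phi> v) \<in> parcs (H \<boxtimes> path_graph m)"
    using embedsE[OF emb] by metis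
  obtain T :: "nat pair_pre_digraph" and B where dec: "tree_decomposition H T B"
    and width: "decomposition_width T B = treewidth H"
    using treewidth_attained[OF H] by metis
  have T: "undirected_tree T" using dec by (simp add: tree_decomposition_def)
  interpret T: pair_graph T using T by (simp add: undirected_tree_def)
  define s where "s = snd (\<phi> c)"
  define B' where "B' t = {u \<in> U. fst (\<phi> u) \<in> B t}" for t
  have \<phi>H: "fst (\<phi> u) \<in> pverts H" if "u \<in> U" for u
    using \<phi>(2) UG that by (force simp: strong_product_def)
  have finB: "finite (B t)" if "t \<in> pverts T" for t
  proof -
    have "B t \<subseteq> pverts H" using dec that by (auto simp: tree_decomposition_def)
    then show ?thesis using H.pair_finite_verts finite_subset by blast
  qed
  have bags: "connected_in (parcs T) {t \<in> pverts T. u \<in> B' t} \<and> {t \<in> pverts T. u \<in> B' t} \<noteq> {}"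
    if u: "u \<in> U" for u
  proof -
    have "Digraph_Component.connected (with_proj T \<restriction> {t \<in> pverts T. fst (\<phi> u) \<in> B t})"
      using dec \<phi>H[OF u] by (auto simp: tree_decomposition_def)
    then show ?thesis
      using connected_induced_imp_connected_in[OF T.pair_graph] u
      unfolding B'_def by fastforce
  qed
  have edges: "\<exists>t\<in>pverts T. u \<in> B' t \<and> v \<in> B' t"
    if uv: "(u, v) \<in> parcs G" "u \<in> U" "v \<in> U" for u v
  proof -
    have "fst (\<phi> u) = fst (\<phi> v) \<or> (fst (\<phi> u), fst (\<phi> v)) \<in> parcs H"
      using \<phi>(3)[OF uv(1)] by (auto simp: strong_product_def)
    then show ?thesis
    proof
      assume "fst (\<phi> u) = fst (\<phi> v)"
      then show ?thesis using bags[OF uv(2)] uv by (auto simp: B'_def)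
    next
      assume "(fst (\<phi> u), fst (\<phi> v)) \<in> parcs H"
      then show ?thesis using dec uv by (fastforce simp: tree_decomposition_def B'_def)
    qed
  qed
  have three_rows: "snd (\<phi> u) \<in> {s - 1..s + 1}" if u: "u \<in> U" for u
    using dom(2)[OF u] \<phi>(3)[of c u] by (auto simp: strong_product_def path_graph_def s_def)
  have bound: "card (B' t) \<le> 3 * card (B t)" and finB': "finite (B' t)" if t: "t \<in> pverts T" for t
  proof -
    have sub: "\<phi> ` B' t \<subseteq> B t \<times> {s - 1..s + 1}"
    proof (rule image_subsetI)
      fix u assume "u \<in> B' t"
      then have "u \<in> U" "fst (\<phi> u) \<in> B t" by (auto simp: B'_def)
      then show "\<phi> u \<in> B t \<times> {s - 1..s + 1}"
        using three_rows[of u] unfolding mem_Times_iff by blast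
    qed
    have inj: "inj_on \<phi> (B' t)" using \<phi>(1) UG by (auto simp: B'_def inj_on_def)
    have fin: "finite (B t \<times> {s - 1..s + 1})" using finB[OF t] by simp
    then show "finite (B' t)" using inj sub by (meson finite_imageD finite_subset)
    have "card (B' t) = card (\<phi> ` B' t)" using inj by (simp add: card_image)
    also have "\<dots> \<le> card (B t \<times> {s - 1..s + 1})" using fin sub by (rule card_mono)
    also have "\<dots> = card {s - 1..s + 1} * card (B t)" by (simp add: card_cartesian_product)
    also have "\<dots> \<le> 3 * card (B t)"
    proof (rule mult_right_mono)
      have "card {s - 1..s + 1} = s + 2 - (s - 1)" by simp
      then show "card {s - 1..s + 1} \<le> 3" by linarith
    qed simp
    finally show "card (B' t) \<le> 3 * card (B t)" .
  qed
  have "sym (parcs G)" using arcs_symmetric by (auto simp: sym_def)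
  obtain t where t: "t \<in> pverts T" "card A \<le> card (B' t)"
    by (rule bag_large_if_biclique_of_rows[OF T, where U = U and B = B' and E = "parcs G"
          and A = A and R = R and X = X])
      (use bags edges finB' \<open>sym (parcs G)\<close> rows disj X adj in blast)+
  have "card (B t) \<le> Max ((\<lambda>t. card (B t)) ` pverts T)"
    using t(1) T.pair_finite_verts by (intro Max_ge) auto
  also have "\<dots> \<le> row_treewidth G + 1"
    using width tw by (simp add: decomposition_width_def)
  finally have "3 * card (B t) \<le> 3 * (row_treewidth G + 1)" by (rule mult_left_mono) simp
  with t(2) bound[OF t(1)] show ?thesis by (meson order_trans)
qed

section \<open>Adjacency of lattice points in the hyperbolic plane\<close>

text \<open>Apply \<open>cosh\<close>, which is monotone here, and use \<open>cosh (2 * \<rho>) = 1 + 2 * (sinh \<rho>)\<^sup>2\<close>.\<close>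

lemma hyp_dist_le_iff:
  assumes "0 < Im z" "0 < Im w" "0 \<le> \<rho>"
  shows "hyp_dist z w \<le> 2 * \<rho> \<longleftrightarrow> (cmod (z - w))\<^sup>2 \<le> (2 * sinh \<rho>)\<^sup>2 * Im z * Im w"
proof -
  define q where "q = (cmod (z - w))\<^sup>2 / (2 * Im z * Im w)"
  have q: "0 \<le> q" using assms by (simp add: q_def)
  have "hyp_dist z w \<le> 2 * \<rho> \<longleftrightarrow> cosh (arcosh (1 + q)) \<le> cosh (2 * \<rho>)"
    using q assms(3) by (subst cosh_real_nonneg_le_iff) (auto simp: hyp_dist_def q_def)
  also have "\<dots> \<longleftrightarrow> 1 + q \<le> 1 + 2 * (sinh \<rho>)\<^sup>2"
    using q by (simp add: cosh_double cosh_square_eq)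
  also have "\<dots> \<longleftrightarrow> (cmod (z - w))\<^sup>2 \<le> (2 * sinh \<rho>)\<^sup>2 * Im z * Im w"
    using assms by (simp add: q_def divide_le_eq power_mult_distrib) (simp add: algebra_simps)
  finally show ?thesis .
qed

text \<open>
  A label \<open>(a, m)\<close> stands for the point of index \<open>m\<close> on level \<open>a\<close>.
\<close>

type_synonym label = "nat \<times> nat"

definition xpos :: "label \<Rightarrow> real" where
  "xpos u = (real (snd u) + 1 / 2) * 4 ^ fst u"

text \<open>
  The factor \<open>K\<close> will be \<open>2 * sinh \<rho>\<close>, which turns the horizontal reach of a disk into the geometric mean
  of the two heights.
\<close>

definition lattice_point :: "real \<Rightarrow> label \<Rightarrow> complex" where
  "lattice_point K u = Complex (K * xpos u) (4 ^ fst u)"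

definition near :: "real \<Rightarrow> label \<Rightarrow> label \<Rightarrow> bool" where
  "near K u v \<longleftrightarrow>
    K\<^sup>2 * (xpos u - xpos v)\<^sup>2 + (4 ^ fst u - 4 ^ fst v)\<^sup>2 \<le> K\<^sup>2 * 4 ^ fst u * 4 ^ fst v"

lemma near_sym: "near K u v \<Longrightarrow> near K v u"
  unfolding near_def by (simp add: power2_commute mult.commute mult.left_commute)

lemma hyp_dist_lattice_point:
  assumes "0 \<le> \<rho>"
  shows "hyp_dist (lattice_point (2 * sinh \<rho>) u) (lattice_point (2 * sinh \<rho>) v) \<le> 2 * \<rho> \<longleftrightarrow>
    near (2 * sinh \<rho>) u v"
proof -
  have "(K * xpos u - K * xpos v)\<^sup>2 = K\<^sup>2 * (xpos u - xpos v)\<^sup>2" for K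
    by (simp add: power_mult_distrib flip: right_diff_distrib)
  then show ?thesis
    using assms by (simp add: hyp_dist_le_iff lattice_point_def near_def cmod_power2)
qed

lemma four_power: "(4::real) ^ n = (2 ^ n)\<^sup>2"
  by (simp add: power2_eq_square flip: power_mult_distrib)

lemma near_imp_xpos_close:
  assumes "near K u v" "0 < K"
  shows "\<bar>xpos u - xpos v\<bar> \<le> 2 ^ (fst u + fst v)"
proof -
  have "K\<^sup>2 * (xpos u - xpos v)\<^sup>2 \<le> K\<^sup>2 * (4 ^ fst u * 4 ^ fst v)"
    using assms(1) zero_le_power2[of "4 ^ fst u - 4 ^ fst v :: real"]
    unfolding near_def mult.assoc by linarith
  then have "(xpos u - xpos v)\<^sup>2 \<le> 4 ^ fst u * 4 ^ fst v"
    using assms(2) by (simp add: mult_le_cancel_left)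
  also have "\<dots> = (2 ^ (fst u + fst v))\<^sup>2"
    by (simp add: four_power power_add power_mult_distrib)
  finally show ?thesis by (simp add: power2_le_iff_abs_le)
qed

text \<open>
  The term \<open>(4 ^ fst u - 4 ^ fst v)\<^sup>2\<close> takes up at most half of the right-hand side of the
  adjacency condition, because the heights are at least \<open>1\<close> and at most \<open>K\<^sup>2 / 2\<close>.
\<close>

lemma nearI:
  assumes x: "2 * (xpos u - xpos v)\<^sup>2 \<le> 4 ^ fst u * 4 ^ fst v"
    and K: "2 * 4 ^ fst u \<le> K\<^sup>2" "2 * 4 ^ fst v \<le> K\<^sup>2"
  shows "near K u v"
proof -
  define s t :: real where st: "s = 4 ^ fst u" "t = 4 ^ fst v"
  have one: "1 \<le> s" "1 \<le> t" by (auto simp: st)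
  have aux: "2 * (s - t)\<^sup>2 \<le> K\<^sup>2 * (s * t)" if "1 \<le> t" "t \<le> s" "2 * s \<le> K\<^sup>2" for s t :: real
  proof -
    have "(s - t)\<^sup>2 \<le> s\<^sup>2" using that by (intro power_mono) auto
    also have "s\<^sup>2 \<le> s * (s * t)"
      using mult_left_mono[of 1 t "s * s"] that by (simp add: power2_eq_square mult.assoc)
    finally have "2 * (s - t)\<^sup>2 \<le> (2 * s) * (s * t)" by simp
    also have "\<dots> \<le> K\<^sup>2 * (s * t)" using that by (intro mult_right_mono) auto
    finally show ?thesis .
  qed
  have "2 * (s - t)\<^sup>2 \<le> K\<^sup>2 * (s * t)"
    using aux[of t s] aux[of s t] one K
    by (cases "t \<le> s") (auto simp: st power2_commute mult.commute)
  moreover have "K\<^sup>2 * (2 * (xpos u - xpos v)\<^sup>2) \<le> K\<^sup>2 * (s * t)"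
    using x by (intro mult_left_mono) (auto simp: st)
  ultimately show ?thesis unfolding near_def st[symmetric] mult.assoc by linarith
qed

text \<open>
  On a common level the height difference vanishes, and the spacing \<open>4 ^ a\<close> is exactly the reach.
\<close>

lemma near_Suc: "near K (a, m) (a, Suc m)"
  by (simp add: near_def xpos_def algebra_simps power2_eq_square)

section \<open>Levels of cliques\<close>

text \<open>
  In terms of the gaps above \<open>i\<close>, this says that \<open>k - i\<close> is at least \<open>2 * (j - i) - 1\<close>.
\<close>

definition doubling_gaps :: "nat set \<Rightarrow> bool" where
  "doubling_gaps J \<longleftrightarrow> (\<forall>i\<in>J. \<forall>j\<in>J. \<forall>k\<in>J. i < j \<longrightarrow> j < k \<longrightarrow> 2 * j \<le> i + k + 1)"

text \<open>
  The abscissa of \<open>q\<close> is an even multiple of \<open>4 ^ fst p\<close>, whereas that of \<open>p\<close> is half-integral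
  in these units.
\<close>

lemma xpos_separated:
  assumes "fst p < fst q"
  shows "4 ^ fst p / 2 \<le> \<bar>xpos p - xpos q\<bar>"
proof -
  obtain d where d: "fst q = Suc (fst p + d)" using assms less_iff_Suc_add by auto
  define N :: int where "N = int (snd p) - (2 * int (snd q) + 1) * 2 * 4 ^ d"
  have "xpos p - xpos q = (real_of_int N + 1 / 2) * 4 ^ fst p"
    by (simp add: xpos_def d N_def power_add algebra_simps)
  moreover have "1 / 2 \<le> \<bar>real_of_int N + 1 / 2\<bar>"
    by (cases "0 \<le> N") (auto simp: abs_if)
  ultimately show ?thesis
    by (simp add: abs_mult)
qed

text \<open>
  Both \<open>p\<close> and \<open>q\<close> are close to \<open>y\<close>, so they are close to each other; comparing with their separation
  bounds \<open>4 ^ fst p\<close> by \<open>3 * 2 ^ (fst y + fst q)\<close>, and \<open>3 < 4\<close> saves one unit in the exponent.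
\<close>

lemma near_level_gap:
  assumes K: "0 < K" and p: "near K y p" and q: "near K y q" and lt: "fst p < fst q"
  shows "2 * fst p \<le> fst y + fst q + 1"
proof -
  define i j k where ijk: "i = fst y" "j = fst p" "k = fst q"
  have "4 ^ j / 2 \<le> \<bar>xpos p - xpos q\<bar>" using xpos_separated[OF lt] by (simp add: ijk)
  also have "\<dots> \<le> \<bar>xpos y - xpos p\<bar> + \<bar>xpos y - xpos q\<bar>" by linarith
  also have "\<dots> \<le> 2 ^ (i + j) + 2 ^ (i + k)"
    using near_imp_xpos_close[OF p K] near_imp_xpos_close[OF q K] by (simp add: ijk)
  finally have "(4::real) ^ j \<le> 2 * 2 ^ (i + j) + 2 * 2 ^ (i + k)" by simp
  also have "2 * (2::real) ^ (i + j) = 2 ^ (i + j + 1)" by simp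
  also have "(2::real) ^ (i + j + 1) \<le> 2 ^ (i + k)"
    using lt by (intro power_increasing) (auto simp: ijk)
  also have "(2::real) ^ (i + k) + 2 * 2 ^ (i + k) < 2 ^ (i + k + 2)" by simp
  finally have "(4::real) ^ j < 2 ^ (i + k + 2)" by simp
  moreover have "(4::real) ^ j = 2 ^ (2 * j)" by (simp add: power_mult)
  ultimately have "2 * j < i + k + 2"
    by (metis one_less_numeral_iff power_less_imp_less_exp semiring_norm(76))
  then show ?thesis by (simp add: ijk)
qed

text \<open>On a single level, the indices of pairwise adjacent points differ by at most 1.\<close>

lemma card_pairwise_near_le:
  assumes K: "0 < K" and fin: "finite Q"
    and near: "\<And>u v. u \<in> Q \<Longrightarrow> v \<in> Q \<Longrightarrow> u \<noteq> v \<Longrightarrow> near K u v"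
  shows "card Q \<le> 2 * card (fst ` Q)"
proof -
  have fiber: "card {u \<in> Q. fst u = a} \<le> 2" if a: "a \<in> fst ` Q" for a
  proof -
    define S where "S = snd ` {u \<in> Q. fst u = a}"
    have finS: "finite S" "S \<noteq> {}" using fin a by (auto simp: S_def)
    have step: "m' \<le> Suc m" if "m \<in> S" "m' \<in> S" for m m'
    proof (cases "m = m'")
      case False
      have "(a, m) \<in> Q" "(a, m') \<in> Q" using that by (auto simp: S_def)
      then have "near K (a, m) (a, m')" using near False by auto
      from near_imp_xpos_close[OF this K]
      have "\<bar>xpos (a, m) - xpos (a, m')\<bar> \<le> 4 ^ a"
        by (simp add: power_add flip: power_mult_distrib)
      moreover have "xpos (a, m) - xpos (a, m') = (real m - real m') * 4 ^ a"
        by (simp add: xpos_def algebra_simps)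
      ultimately have "\<bar>real m - real m'\<bar> \<le> 1" by (simp add: abs_mult)
      then show ?thesis by linarith
    qed simp
    have "S \<subseteq> {Min S, Suc (Min S)}"
    proof -
      have "m = Min S \<or> m = Suc (Min S)" if "m \<in> S" for m
        using Min_le[OF finS(1) that] step[OF Min_in[OF finS] that] by linarith
      then show ?thesis by blast
    qed
    then have "card S \<le> card {Min S, Suc (Min S)}" by (intro card_mono) auto
    moreover have "card S = card {u \<in> Q. fst u = a}"
      unfolding S_def by (intro card_image) (auto simp: inj_on_def prod_eq_iff)
    ultimately show ?thesis by simp
  qed
  have "Q = (\<Union>a\<in>fst ` Q. {u \<in> Q. fst u = a})" by auto
  then have "card Q = card (\<Union>a\<in>fst ` Q. {u \<in> Q. fst u = a})" by (rule arg_cong)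
  also have "\<dots> \<le> (\<Sum>a\<in>fst ` Q. card {u \<in> Q. fst u = a})"
    using fin by (intro card_UN_le) simp
  also have "\<dots> \<le> (\<Sum>a\<in>fst ` Q. 2)" using fiber by (rule sum_mono)
  finally show ?thesis by (simp add: mult.commute)
qed

lemma pairwise_near_doubling_gaps:
  assumes K: "0 < K"
    and near: "\<And>u v. u \<in> Q \<Longrightarrow> v \<in> Q \<Longrightarrow> u \<noteq> v \<Longrightarrow> near K u v"
  shows "doubling_gaps (fst ` Q)"
  unfolding doubling_gaps_def
proof safe
  fix y z p w q v assume *: "(y, z) \<in> Q" "(p, w) \<in> Q" "(q, v) \<in> Q"
    "fst (y, z) < fst (p, w)" "fst (p, w) < fst (q, v)"
  then have "near K (y, z) (p, w)" "near K (y, z) (q, v)" using near by auto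
  from near_level_gap[OF K this] *
  show "2 * fst (p, w) \<le> fst (y, z) + fst (q, v) + 1" by simp
qed

text \<open>
  With \<open>i\<close> the smallest element, the quantity \<open>j - i - 1\<close> at least doubles from one element to the next
  as soon as it is positive. It is not positive only for \<open>i\<close> and \<open>i + 1\<close>, which are set aside; they
  account for a factor of \<open>4\<close>.
\<close>

lemma doubling_gaps_card_le_log:
  assumes J: "doubling_gaps J" "J \<subseteq> {..M}" and M: "1 \<le> M"
  shows "2 ^ card J \<le> 8 * M"
proof (cases "J = {}")
  case True
  then show ?thesis using M by simp
next
  case False
  have finJ: "finite J" using J(2) finite_subset by blast
  define i where "i = Min J"
  have i: "i \<in> J" "\<And>j. j \<in> J \<Longrightarrow> i \<le> j" using False finJ by (auto simp: i_def)
  have grow: "2 ^ card S \<le> 2 * (Max S - i - 1)"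
    if "finite S" "S \<noteq> {}" "S \<subseteq> J - {i, Suc i}" for S
    using that
  proof (induction S rule: finite_linorder_max_induct)
    case (insert b S)
    have b: "Suc i < b" using insert.prems i(2)[of b] by auto
    have Max_b: "Max (insert b S) = b" using insert.hyps by (intro Max_eqI) (auto simp: less_imp_le)
    have card: "card (insert b S) = Suc (card S)" using insert.hyps by (auto simp: card_insert_if)
    show ?case
    proof (cases "S = {}")
      case True
      then show ?thesis using b by simp
    next
      case False
      then have "Max S \<in> S" using insert.hyps by simp
      then have "2 * Max S \<le> i + b + 1" "i < Max S"
        using J(1) i insert.hyps insert.prems unfolding doubling_gaps_def by (auto simp: le_neq_implies_less)
      then have "2 * (Max S - i - 1) \<le> b - i - 1" by linarith
      moreover have "2 ^ card S \<le> 2 * (Max S - i - 1)" using insert.IH False insert.prems by auto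
      ultimately show ?thesis unfolding Max_b card by simp
    qed
  qed simp
  have cardJ: "card J \<le> card (J - {i, Suc i}) + 2"
  proof -
    have "card J \<le> card ((J - {i, Suc i}) \<union> {i, Suc i})" using finJ by (intro card_mono) auto
    also have "\<dots> \<le> card (J - {i, Suc i}) + card {i, Suc i}" by (rule card_Un_le)
    finally show ?thesis by simp
  qed
  have S: "2 ^ card (J - {i, Suc i}) \<le> 2 * M"
  proof (cases "J - {i, Suc i} = {}")
    case True
    then show ?thesis using M by (metis card.empty le_add2 le_trans mult_2 one_add_one power_0)
  next
    case False
    then have "Max (J - {i, Suc i}) \<in> J" using finJ Max_in[of "J - {i, Suc i}"] by blast
    then have "Max (J - {i, Suc i}) \<le> M" using J(2) by auto
    moreover have "2 ^ card (J - {i, Suc i}) \<le> 2 * (Max (J - {i, Suc i}) - i - 1)"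
      using False finJ by (intro grow) auto
    ultimately show ?thesis by linarith
  qed
  have "(2::nat) ^ card J \<le> 2 ^ (card (J - {i, Suc i}) + 2)" using cardJ by (intro power_increasing) auto
  then show ?thesis using S by simp
qed

text \<open>
  For \<open>i = D - 2 ^ m < j < k\<close> in the set, \<open>j\<close> is already at least halfway from \<open>i\<close> to \<open>D\<close>, so doubling
  the gap leaves only \<open>k = D - 1\<close>. Hence at most three such levels occur together, besides
  the three exceptional values.
\<close>

lemma doubling_gaps_card_le_6:
  assumes J: "doubling_gaps J" and sub: "J \<subseteq> (\<lambda>m. D - 2 ^ m) ` {m. 2 ^ m \<le> D} \<union> {0, D, M}"
  shows "card J \<le> 6"
proof -
  let ?A = "(\<lambda>m. D - 2 ^ m) ` {m. 2 ^ m \<le> D}"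
  define J' where "J' = J - {0, D, M}"
  have "finite {m. 2 ^ m \<le> D}"
  proof (rule finite_subset)
    have "m \<le> D" if "2 ^ m \<le> D" for m using less_exp[of m] that by linarith
    then show "{m. 2 ^ m \<le> D} \<subseteq> {..D}" by blast
  qed simp
  then have finJ: "finite J" by (intro finite_subset[OF sub]) simp
  have last: "k = D - 1" if ijk: "i \<in> J'" "j \<in> J'" "k \<in> J'" "i < j" "j < k" for i j k
  proof -
    have A: "i \<in> ?A" "j \<in> ?A" "k \<in> ?A" using ijk sub by (auto simp: J'_def)
    obtain m l h where m: "i = D - 2 ^ m" "2 ^ m \<le> D" and l: "j = D - 2 ^ l" "2 ^ l \<le> D"
      and h: "k = D - 2 ^ h" "2 ^ h \<le> D"
      using A by blast
    have "(2::nat) ^ l < 2 ^ m" using ijk m l by linarith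
    then have "Suc l \<le> m" by simp
    then have "(2::nat) ^ Suc l \<le> 2 ^ m" by (intro power_increasing) auto
    moreover have "2 * j \<le> i + k + 1" using J ijk unfolding doubling_gaps_def J'_def by blast
    ultimately have "(2::nat) ^ h \<le> 1" using m l h ijk by simp
    then show ?thesis using h by (metis le_antisym one_le_power one_le_numeral)
  qed
  have "card J' \<le> 3"
  proof (rule ccontr)
    assume "\<not> ?thesis"
    then have c4: "4 \<le> card J'" by simp
    have fin: "finite J'" using finJ by (simp add: J'_def)
    define xs where "xs = sorted_list_of_set J'"
    have xs: "sorted xs" "distinct xs" "set xs = J'" "4 \<le> length xs"
      using c4 fin by (auto simp: xs_def)
    have lt: "xs ! 0 < xs ! 1" "xs ! 1 < xs ! 2" "xs ! 2 < xs ! 3"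
      using sorted_wrt_nth_less[of "(<)" xs] xs by (simp_all add: strict_sorted_iff)
    have "xs ! 0 \<in> J'" "xs ! 1 \<in> J'" "xs ! 2 \<in> J'" "xs ! 3 \<in> J'"
      using xs by (auto intro!: nth_mem simp flip: xs(3))
    with lt have "xs ! 2 = D - 1" "xs ! 3 = D - 1"
      using last[of "xs ! 0" "xs ! 1" "xs ! 2"] last[of "xs ! 0" "xs ! 1" "xs ! 3"] by auto
    with lt show False by simp
  qed
  moreover have "card J \<le> card J' + card {0, D, M}"
  proof -
    have "J \<subseteq> J' \<union> {0, D, M}" by (auto simp: J'_def)
    then have "card J \<le> card (J' \<union> {0, D, M})" using finJ by (intro card_mono) (auto simp: J'_def)
    also have "\<dots> \<le> card J' + card {0, D, M}" by (rule card_Un_le)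
    finally show ?thesis .
  qed
  moreover have "card {0, D, M} \<le> 3" by (simp add: card_insert_if)
  ultimately show ?thesis by linarith
qed

section \<open>Lattice graphs\<close>

lemma clique_number_le:
  fixes G :: "'a pair_pre_digraph"
  assumes G: "pair_graph G"
    and bound: "\<And>Q. Q \<subseteq> pverts G \<Longrightarrow>
      (\<And>u v. u \<in> Q \<Longrightarrow> v \<in> Q \<Longrightarrow> u \<noteq> v \<Longrightarrow> (u, v) \<in> parcs G) \<Longrightarrow> card Q \<le> N"
  shows "clique_number G \<le> N"
proof -
  interpret pair_graph G by (rule G)
  \<comment> \<open>The maximum is meaningful: the set contains \<open>0\<close>, by the empty subgraph, and is bounded.\<close>
  define S where "S = {k. \<exists>K. subgraph K (with_proj G) \<and> complete_digraph k K}"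
  have le: "k \<le> N" if k: "k \<in> S" for k
  proof -
    obtain K where K: "subgraph K (with_proj G)" "complete_digraph k K"
      using k by (auto simp: S_def)
    have "card (verts K) \<le> N"
    proof (rule bound)
      show "verts K \<subseteq> pverts G" using K(1) by (auto simp: subgraph_def)
      fix u v assume "u \<in> verts K" "v \<in> verts K" "u \<noteq> v"
      then have "(u, v) \<in> arcs_ends K" using K(2) by (simp add: complete_digraph_def)
      then show "(u, v) \<in> parcs G" using arcs_ends_mono[OF K(1)] by auto
    qed
    then show ?thesis using K(2) by (simp add: complete_digraph_def)
  qed
  have "subgraph (with_proj \<lparr>pverts = {}, parcs = {}\<rparr>) (with_proj G)"
  proof (rule subgraphI)
    show "wf_digraph (with_proj \<lparr>pverts = {} :: 'a set, parcs = {}\<rparr>)" by unfold_locales auto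
  qed (use wf_digraph_axioms in auto)
  moreover have "complete_digraph 0 (with_proj \<lparr>pverts = ({} :: 'a set), parcs = {}\<rparr>)"
    by (auto simp: complete_digraph_pair_def)
  ultimately have "0 \<in> S" by (auto simp: S_def)
  moreover have "S \<subseteq> {..N}" using le by auto
  then have "finite S" by (rule finite_subset) simp
  ultimately show ?thesis
    using le unfolding clique_number_def S_def[symmetric] by (intro Max.boundedI) auto
qed


lemma connected_in_interval_image:
  assumes sym: "sym E" and step: "\<And>m. l \<le> m \<Longrightarrow> Suc m < h \<Longrightarrow> (f m, f (Suc m)) \<in> E"
  shows "connected_in E (f ` {l..<h})"
proof -
  let ?R = "E \<inter> f ` {l..<h} \<times> f ` {l..<h}"
  have up: "(f m, f m') \<in> ?R\<^sup>*" if "l \<le> m" "m \<le> m'" "m' < h" for m m'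
    using that(2,3)
  proof (induction m' rule: dec_induct)
    case (step k)
    have "(f k, f (Suc k)) \<in> ?R" using assms(2)[of k] step.hyps step.prems that(1) by auto
    with step show ?case by (auto intro: rtrancl_into_rtrancl)
  qed simp
  have "sym (?R\<^sup>*)" using sym by (intro sym_rtrancl) (auto simp: sym_def)
  then have "(f m, f m') \<in> ?R\<^sup>*" if "l \<le> m" "m < h" "l \<le> m'" "m' < h" for m m'
    using up[of m m'] up[of m' m] that by (cases "m \<le> m'") (auto dest: symD)
  then show ?thesis unfolding connected_in_def by auto
qed


text \<open>
  The offset \<open>row_start D a * 4 ^ a = 4 ^ (4 * D) / 2\<close> does not depend on \<open>a\<close>: all rows begin at the abscissa of the
  dominating point \<open>(4 * D, 0)\<close>, so that this point belongs to the same lattice.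
\<close>

definition row_start :: "nat \<Rightarrow> nat \<Rightarrow> nat" where
  "row_start D a = 2 * 4 ^ (4 * D - a - 1)"

definition row :: "nat \<Rightarrow> nat \<Rightarrow> label set" where
  "row D a = Pair a ` {row_start D a..<row_start D a + D * 4 ^ (D - a)}"

definition core :: "nat \<Rightarrow> nat set \<Rightarrow> label set" where
  "core D A = insert (4 * D, 0) (\<Union>a\<in>insert D A. row D a)"

lemma xpos_row:
  assumes "a < 4 * D"
  shows "xpos (a, row_start D a + m) = 4 ^ (4 * D) / 2 + (real m + 1 / 2) * 4 ^ a"
proof -
  obtain d where "4 * D = Suc (a + d)" using assms less_iff_Suc_add by auto
  then show ?thesis by (simp add: xpos_def row_start_def power_add algebra_simps)
qed

text \<open>
  All rows lie within \<open>D * 4 ^ D \<le> 8 ^ D\<close> of the dominating point, whose reach is at least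
  \<open>2 ^ (4 * D) = 16 ^ D\<close>.
\<close>

lemma center_near_row:
  assumes D: "1 \<le> D" and a: "a \<le> D" and K: "2 * 4 ^ (4 * D) \<le> K\<^sup>2" and u: "u \<in> row D a"
  shows "near K (4 * D, 0) u"
proof (rule nearI)
  obtain m where m: "u = (a, row_start D a + m)" "m < D * 4 ^ (D - a)"
    using u by (auto simp: row_def le_iff_add)
  have "(m + 1) * 4 ^ a \<le> D * 4 ^ (D - a) * (4::nat) ^ a" using m(2) by (intro mult_right_mono) auto
  also have "\<dots> = D * 4 ^ D" using a by (simp add: mult.assoc flip: power_add)
  finally have "real ((m + 1) * 4 ^ a) \<le> real (D * 4 ^ D)" by (simp only: of_nat_le_iff)
  then have "(real m + 1) * 4 ^ a \<le> real D * 4 ^ D" by (simp add: algebra_simps)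
  moreover have "(real m + 1 / 2) * 4 ^ a \<le> (real m + 1) * 4 ^ a" by (intro mult_right_mono) auto
  ultimately have le: "(real m + 1 / 2) * 4 ^ a \<le> real D * 4 ^ D" by (rule order_trans[rotated])
  have "2 * (xpos (4 * D, 0) - xpos u)\<^sup>2 = 2 * ((real m + 1 / 2) * 4 ^ a)\<^sup>2"
    using a D by (simp add: m(1) xpos_row) (simp add: xpos_def)
  also have "\<dots> \<le> 2 * (real D * 4 ^ D)\<^sup>2"
    using le by (intro mult_left_mono power_mono) auto
  also have "\<dots> \<le> 2 * (2 ^ D * 4 ^ D)\<^sup>2"
    using of_nat_less_two_power[of D, where ?'a = real]
    by (intro mult_left_mono power_mono mult_right_mono) auto
  also have "\<dots> = 2 * 64 ^ D" by (simp add: power2_eq_square flip: power_mult_distrib)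
  also have "\<dots> \<le> 4 ^ D * 64 ^ D"
    using D power_increasing[of 1 D "4::real"] by (intro mult_right_mono) auto
  also have "\<dots> = 4 ^ (4 * D)" by (simp add: power_mult flip: power_mult_distrib)
  also have "\<dots> \<le> 4 ^ fst (4 * D, 0::nat) * 4 ^ fst u" by simp
  finally show "2 * (xpos (4 * D, 0) - xpos u)\<^sup>2 \<le> 4 ^ fst (4 * D, 0::nat) * 4 ^ fst u" .
  show "2 * 4 ^ fst (4 * D, 0::nat) \<le> K\<^sup>2" using K by simp
  have "(4::real) ^ a \<le> 4 ^ (4 * D)" using a by (intro power_increasing) auto
  then show "2 * 4 ^ fst u \<le> K\<^sup>2" using K unfolding m(1) fst_conv by linarith
qed

text \<open>
  The abscissa of \<open>u\<close> is a multiple of \<open>4 ^ a\<close>, and the point of level \<open>a\<close> half a unit to its right is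
  a neighbour inside the row.
\<close>

lemma top_near_row:
  assumes a: "a < D" and K: "2 * 4 ^ (4 * D) \<le> K\<^sup>2" and u: "u \<in> row D D"
  shows "\<exists>v\<in>row D a. near K u v"
proof -
  obtain c where c: "u = (D, row_start D D + c)" "c < D"
    using u by (auto simp: row_def le_iff_add)
  obtain d where d: "D = Suc (a + d)" using a less_iff_Suc_add by auto
  define m where "m = c * 4 ^ (D - a) + 2 * 4 ^ d"
  have "m < (c + 1) * 4 ^ (D - a)" by (simp add: m_def d)
  also have "\<dots> \<le> D * 4 ^ (D - a)" using c(2) by (intro mult_right_mono) auto
  finally have "(a, row_start D a + m) \<in> row D a" by (simp add: row_def)
  moreover have "near K u (a, row_start D a + m)"
  proof (rule nearI)
    have "xpos u - xpos (a, row_start D a + m) = (real c + 1 / 2) * 4 ^ D - (real m + 1 / 2) * 4 ^ a"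
      using a by (simp add: c(1) xpos_row)
    also have "\<dots> = - (4 ^ a) / 2" by (simp add: m_def d power_add algebra_simps)
    finally have "2 * (xpos u - xpos (a, row_start D a + m))\<^sup>2 = 4 ^ a * 4 ^ a / 2"
      by (simp add: power2_eq_square)
    also have "\<dots> \<le> 4 ^ a * 4 ^ a" by simp
    also have "\<dots> \<le> 4 ^ D * 4 ^ a" using a by (intro mult_right_mono power_increasing) auto
    finally show "2 * (xpos u - xpos (a, row_start D a + m))\<^sup>2
        \<le> 4 ^ fst u * 4 ^ fst (a, row_start D a + m)" by (simp add: c(1))
    have "(4::real) ^ a \<le> 4 ^ (4 * D)" "(4::real) ^ D \<le> 4 ^ (4 * D)"
      using a by (auto intro!: power_increasing)
    then show "2 * 4 ^ fst u \<le> K\<^sup>2" "2 * 4 ^ fst (a, row_start D a + m) \<le> K\<^sup>2"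
      using K unfolding c(1) fst_conv by linarith+
  qed
  ultimately show ?thesis by blast
qed

lemma card_row: "card (row D a) = D * 4 ^ (D - a)"
  by (simp add: row_def card_image inj_on_def)

lemma finite_row: "finite (row D a)"
  by (simp add: row_def)

text \<open>
  The only purpose of this crude bound is a simple power; it decides how small the ratio of \<open>D\<close> and \<open>r n\<close>
  has to be.
\<close>

lemma card_core_le:
  assumes D: "1 \<le> D" and A: "A \<subseteq> {..<D}"
  shows "finite (core D A)" "card (core D A) \<le> 64 ^ D"
proof -
  have finA: "finite (insert D A)" using A finite_subset by auto
  then show "finite (core D A)" by (simp add: core_def finite_row)
  have "card (core D A) \<le> 1 + card (\<Union>a\<in>insert D A. row D a)"
    unfolding core_def using finA by (simp add: card_insert_if finite_row)
  also have "card (\<Union>a\<in>insert D A. row D a) \<le> (\<Sum>a\<in>insert D A. card (row D a))"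
    using finA by (rule card_UN_le)
  also have "\<dots> \<le> (\<Sum>a\<in>insert D A. D * 4 ^ D)"
    by (intro sum_mono) (auto simp: card_row intro: power_increasing)
  also have "\<dots> = card (insert D A) * (D * 4 ^ D)" by simp
  also have "\<dots> \<le> (D + 1) * (D * 4 ^ D)"
  proof (rule mult_right_mono)
    have "insert D A \<subseteq> {..D}" using A by auto
    then show "card (insert D A) \<le> D + 1" using card_mono[of "{..D}"] by fastforce
  qed simp
  also have "\<dots> \<le> 2 ^ D * (2 ^ D * 4 ^ D)"
    using less_exp[of D] Suc_leI[OF less_exp[of D]] by (intro mult_mono) auto
  also have "\<dots> = 16 ^ D" by (simp flip: power_mult_distrib)
  also have "1 + (16::nat) ^ D \<le> 4 * 16 ^ D" by simp
  also have "\<dots> \<le> 4 ^ D * 16 ^ D"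
    using D power_increasing[of 1 D "4::nat"] by (intro mult_right_mono) auto
  also have "\<dots> = 64 ^ D" by (simp flip: power_mult_distrib)
  finally show "card (core D A) \<le> 64 ^ D" by simp
qed

text \<open>
  Here \<open>exp \<rho> = 2 ^ (4 * D + 2)\<close>; the radius is linear in \<open>D\<close> and still large enough to
  admit all heights up to \<open>4 ^ (4 * D)\<close>.
\<close>

lemma four_power_le_two_sinh_squared:
  "2 * 4 ^ (4 * D) \<le> (2 * sinh ((4 * real D + 2) * ln 2))\<^sup>2"
proof -
  define \<rho> where "\<rho> = (4 * real D + 2) * ln 2"
  have "exp \<rho> = 2 powr (4 * real D + 2)" by (simp add: \<rho>_def powr_def)
  also have "\<dots> = 2 powr real (4 * D + 2)" by (simp add: add.commute)
  also have "\<dots> = 2 ^ (4 * D + 2)" by (rule powr_realpow) simp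
  finally have e: "exp \<rho> = 4 * 2 ^ (4 * D)" by (simp add: power_add)
  have "0 \<le> \<rho>" by (simp add: \<rho>_def)
  then have "exp (- \<rho>) \<le> 1" by simp
  moreover have "(1::real) \<le> 2 ^ (4 * D)" by simp
  ultimately have "2 * 2 ^ (4 * D) \<le> exp \<rho> - exp (- \<rho>)" unfolding e by argo
  also have "\<dots> = 2 * sinh \<rho>" by (simp add: sinh_field_def)
  finally have "2 * 2 ^ (4 * D) \<le> 2 * sinh \<rho>" .
  then have "(2 * 2 ^ (4 * D))\<^sup>2 \<le> (2 * sinh \<rho>)\<^sup>2" by (rule power_mono) simp
  moreover have "(2 * 2 ^ (4 * D))\<^sup>2 = (4::real) * 4 ^ (4 * D)"
    by (simp add: four_power power_mult_distrib)
  moreover have "(0::real) \<le> 4 ^ (4 * D)" by simp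
  ultimately show ?thesis unfolding \<rho>_def by linarith
qed

text \<open>The function \<open>e\<close> numbers the chosen lattice points, so that the vertices are natural numbers.\<close>

definition lattice_graph :: "real \<Rightarrow> (nat \<Rightarrow> label) \<Rightarrow> nat \<Rightarrow> nat pair_pre_digraph" where
  "lattice_graph K e n = \<lparr>pverts = {..<n},
    parcs = {(i, j). i < n \<and> j < n \<and> i \<noteq> j \<and> near K (e i) (e j)}\<rparr>"

lemma pair_graph_lattice_graph: "pair_graph (lattice_graph K e n)"
proof unfold_locales
  show "finite (parcs (lattice_graph K e n))"
    by (rule finite_subset[of _ "{..<n} \<times> {..<n}"]) (auto simp: lattice_graph_def)
qed (auto simp: lattice_graph_def symmetric_def sym_def intro: near_sym)

lemma hudg_lattice_graph:
  assumes \<rho>: "0 < \<rho>"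
  shows "hudg \<rho> (lattice_graph (2 * sinh \<rho>) e n)"
  unfolding hudg_def
proof (intro conjI exI ballI impI)
  let ?p = "\<lambda>i. lattice_point (2 * sinh \<rho>) (e i)"
  show "?p i \<in> hyp_plane" for i by (simp add: hyp_plane_def lattice_point_def)
  show "(i, j) \<in> parcs (lattice_graph (2 * sinh \<rho>) e n) \<longleftrightarrow> hyp_dist (?p i) (?p j) \<le> 2 * \<rho>"
    if "i \<in> pverts (lattice_graph (2 * sinh \<rho>) e n)" "j \<in> pverts (lattice_graph (2 * sinh \<rho>) e n)"
      "i \<noteq> j" for i j
    unfolding hyp_dist_lattice_point[OF less_imp_le[OF \<rho>]] using that by (simp add: lattice_graph_def)
qed (use \<rho> pair_graph_lattice_graph in auto)

lemma clique_number_lattice_graph_le: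
  assumes K: "0 < K" and e: "inj_on e {..<n}"
    and levels: "\<And>J. doubling_gaps J \<Longrightarrow> J \<subseteq> fst ` e ` {..<n} \<Longrightarrow> real (card J) \<le> N"
  shows "real (clique_number (lattice_graph K e n)) \<le> 2 * N"
proof -
  have clique: "real (card Q) \<le> 2 * N"
    if Q: "Q \<subseteq> {..<n}" "\<And>i j. i \<in> Q \<Longrightarrow> j \<in> Q \<Longrightarrow> i \<noteq> j \<Longrightarrow> near K (e i) (e j)" for Q
  proof -
    have inj: "inj_on e Q" using e Q(1) by (rule inj_on_subset)
    have near: "near K u v" if "u \<in> e ` Q" "v \<in> e ` Q" "u \<noteq> v" for u v
      using that Q(2) by blast
    have "finite (e ` Q)" using Q(1) finite_subset by blast
    then have "card (e ` Q) \<le> 2 * card (fst ` e ` Q)"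
      using near by (rule card_pairwise_near_le[OF K])
    then have "card Q \<le> 2 * card (fst ` e ` Q)" using inj by (simp add: card_image)
    moreover have "real (card (fst ` e ` Q)) \<le> N"
    proof (rule levels)
      show "doubling_gaps (fst ` e ` Q)" using near by (rule pairwise_near_doubling_gaps[OF K])
      show "fst ` e ` Q \<subseteq> fst ` e ` {..<n}" using Q(1) by (intro image_mono)
    qed
    ultimately show ?thesis by linarith
  qed
  have "clique_number (lattice_graph K e n) \<le> nat \<lfloor>2 * N\<rfloor>"
  proof (rule clique_number_le[OF pair_graph_lattice_graph])
    fix Q assume "Q \<subseteq> pverts (lattice_graph K e n)"
      and "\<And>i j. i \<in> Q \<Longrightarrow> j \<in> Q \<Longrightarrow> i \<noteq> j \<Longrightarrow> (i, j) \<in> parcs (lattice_graph K e n)"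
    then have "real (card Q) \<le> 2 * N" by (intro clique) (simp_all add: lattice_graph_def)
    then show "card Q \<le> nat \<lfloor>2 * N\<rfloor>" by (simp add: le_nat_floor)
  qed
  moreover have "0 \<le> N" using levels[of "{}"] by (simp add: doubling_gaps_def)
  ultimately show ?thesis by linarith
qed

text \<open>
  The rows of the levels in \<open>A\<close> are the connected sets, and the \<open>D\<close> points of level \<open>D\<close> are the
  vertices adjacent to all of them.
\<close>

lemma card_le_row_treewidth_lattice_graph:
  assumes D: "1 \<le> D" and A: "A \<subseteq> {..<D}" and K: "2 * 4 ^ (4 * D) \<le> K\<^sup>2"
    and e: "bij_betw e {..<n} V" and core: "core D A \<subseteq> V"
  shows "card A \<le> 3 * (row_treewidth (lattice_graph K e n) + 1)"
proof -
  let ?G = "lattice_graph K e n"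
  define g where "g = the_inv_into {..<n} e"
  have g: "bij_betw g V {..<n}" unfolding g_def using e by (rule bij_betw_the_inv_into)
  have injg: "inj_on g V" using g by (simp add: bij_betw_def)
  have gn: "g u < n" if "u \<in> V" for u using bij_betwE[OF g] that by auto
  have eg: "e (g u) = u" if "u \<in> V" for u
    unfolding g_def using e that by (metis bij_betw_def f_the_inv_into_f)
  have arc: "(g u, g v) \<in> parcs ?G" if "u \<in> V" "v \<in> V" "u \<noteq> v" "near K u v" for u v
  proof -
    have "g u \<noteq> g v" using eg that by metis
    then show ?thesis using that gn by (simp add: lattice_graph_def eg)
  qed
  have rowV: "row D a \<subseteq> V" if "a \<in> insert D A" for a
    using that core unfolding core_def by blast
  have cV: "(4 * D, 0) \<in> V" using core unfolding core_def by blast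
  have sym: "sym (parcs ?G)" by (auto simp: lattice_graph_def sym_def intro: near_sym)
  show ?thesis
  proof (rule row_treewidth_ge[OF pair_graph_lattice_graph, where R = "\<lambda>a. g ` row D a"
        and X = "g ` row D D" and U = "\<Union>a\<in>insert D A. g ` row D a" and c = "g (4 * D, 0)"])
    show "g ` row D a \<subseteq> (\<Union>a\<in>insert D A. g ` row D a) \<and> connected_in (parcs ?G) (g ` row D a)"
      if a: "a \<in> A" for a
    proof
      have "connected_in (parcs ?G)
          ((\<lambda>m. g (a, m)) ` {row_start D a..<row_start D a + D * 4 ^ (D - a)})"
      proof (rule connected_in_interval_image[OF sym])
        fix m assume m: "row_start D a \<le> m" "Suc m < row_start D a + D * 4 ^ (D - a)"
        then have "(a, m) \<in> row D a" "(a, Suc m) \<in> row D a" by (auto simp: row_def)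
        then have "(a, m) \<in> V" "(a, Suc m) \<in> V" using rowV[of a] a by blast+
        then show "(g (a, m), g (a, Suc m)) \<in> parcs ?G" using near_Suc by (intro arc) auto
      qed
      then show "connected_in (parcs ?G) (g ` row D a)" by (simp add: row_def image_image)
    qed (use a in blast)
    show "g ` row D a \<inter> g ` row D b = {}" if "a \<in> A" "b \<in> A" "a \<noteq> b" for a b
    proof -
      have "row D a \<inter> row D b = {}" using that(3) by (auto simp: row_def)
      moreover have "g ` (row D a \<inter> row D b) = g ` row D a \<inter> g ` row D b"
        using that rowV[of a] rowV[of b] by (intro inj_on_image_Int[OF injg]) blast+
      ultimately show ?thesis by simp
    qed
    show "g ` row D D \<subseteq> (\<Union>a\<in>insert D A. g ` row D a)" by blast
    have "card A \<le> D" using card_mono[OF _ A] by simp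
    also have "D = card (g ` row D D)"
      using inj_on_subset[OF injg rowV[of D]] by (simp add: card_image card_row)
    finally show "card A \<le> card (g ` row D D)" .
    show "\<exists>y\<in>g ` row D a. (x, y) \<in> parcs ?G" if x: "x \<in> g ` row D D" and a: "a \<in> A" for x a
    proof -
      obtain u where u: "u \<in> row D D" "x = g u" using x by blast
      have aD: "a < D" using a A by auto
      obtain v where v: "v \<in> row D a" "near K u v" using top_near_row[OF aD K u(1)] by blast
      have "u \<noteq> v" using u(1) v(1) aD by (auto simp: row_def)
      moreover have "u \<in> V" "v \<in> V" using u(1) v(1) rowV[of D] rowV[of a] a by blast+
      ultimately have "(g u, g v) \<in> parcs ?G" using v(2) by (intro arc)
      with u v show ?thesis by blast
    qed
    show "(\<Union>a\<in>insert D A. g ` row D a) \<subseteq> pverts ?G"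
    proof (intro UN_least image_subsetI)
      fix a u assume "a \<in> insert D A" "u \<in> row D a"
      then have "u \<in> V" using rowV by blast
      then show "g u \<in> pverts ?G" using gn by (simp add: lattice_graph_def)
    qed
    show "g (4 * D, 0) \<in> pverts ?G" using gn[OF cV] by (simp add: lattice_graph_def)
    show "u = g (4 * D, 0) \<or> (g (4 * D, 0), u) \<in> parcs ?G"
      if u: "u \<in> (\<Union>a\<in>insert D A. g ` row D a)" for u
    proof -
      obtain a w where w: "a \<in> insert D A" "w \<in> row D a" "u = g w" using u by blast
      have aD: "a \<le> D" using w(1) A by auto
      have "w \<in> V" using rowV[OF w(1)] w(2) by blast
      moreover have "(4 * D, 0) \<noteq> w" using w(2) aD D by (auto simp: row_def)
      ultimately have "(g (4 * D, 0), g w) \<in> parcs ?G"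
        using center_near_row[OF D aD K w(2)] cV by (intro arc)
      with w show ?thesis by simp
    qed
  qed
qed

text \<open>
  Padding with points of level \<open>0\<close> keeps the set of levels, on which alone the clique bound depends, under control.
\<close>

lemma core_extension_exists:
  assumes D: "1 \<le> D" and A: "A \<subseteq> {..<D}" and n: "64 ^ D \<le> n"
  obtains V where "finite V" "card V = n" "core D A \<subseteq> V" "fst ` V \<subseteq> A \<union> {0, D, 4 * D}"
proof -
  have fin_core: "finite (core D A)" by (rule card_core_le(1)[OF D A])
  have "infinite (range (Pair 0) :: label set)" by (rule range_inj_infinite) (simp add: inj_on_def)
  then have "infinite (range (Pair 0) - core D A)" using fin_core by (rule Diff_infinite_finite[rotated])
  then obtain W :: "label set" where W: "finite W" "card W = n - card (core D A)"
    "W \<subseteq> range (Pair 0) - core D A"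
    using infinite_arbitrarily_large[of "range (Pair 0) - core D A" "n - card (core D A)"] by metis
  have "card (core D A \<union> W) = card (core D A) + card W"
    using fin_core W by (intro card_Un_disjoint) auto
  then have "card (core D A \<union> W) = n" using W(2) card_core_le(2)[OF D A] n by simp
  moreover have "fst u \<in> A \<union> {0, D, 4 * D}" if "u \<in> core D A \<union> W" for u
    using that
  proof
    assume "u \<in> core D A"
    then show ?thesis by (auto simp: core_def row_def)
  next
    assume "u \<in> W"
    then have "fst u = 0" using W(3) by auto
    then show ?thesis by simp
  qed
  then have "fst ` (core D A \<union> W) \<subseteq> A \<union> {0, D, 4 * D}" by (rule image_subsetI)
  ultimately show ?thesis
    using fin_core W(1) by (intro that[of "core D A \<union> W"]) simp_all
qed

lemma lattice_graph_exists:
  assumes D: "1 \<le> D" and A: "A \<subseteq> {..<D}" and n: "64 ^ D \<le> n"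
    and levels: "\<And>J. doubling_gaps J \<Longrightarrow> J \<subseteq> A \<union> {0, D, 4 * D} \<Longrightarrow> real (card J) \<le> N"
  shows "\<exists>G :: nat pair_pre_digraph. num_verts G = n \<and> hudg ((4 * real D + 2) * ln 2) G \<and>
    real (clique_number G) \<le> 2 * N \<and> card A \<le> 3 * (row_treewidth G + 1)"
proof -
  define \<rho> where "\<rho> = (4 * real D + 2) * ln 2"
  define K where "K = 2 * sinh \<rho>"
  have \<rho>: "0 < \<rho>" by (auto simp: \<rho>_def intro!: mult_pos_pos)
  have Kpos: "0 < K" using \<rho> by (simp add: K_def)
  have K: "2 * 4 ^ (4 * D) \<le> K\<^sup>2"
    unfolding K_def \<rho>_def by (rule four_power_le_two_sinh_squared)
  obtain V where V: "finite V" "card V = n" "core D A \<subseteq> V" "fst ` V \<subseteq> A \<union> {0, D, 4 * D}"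
    using core_extension_exists[OF D A n] by blast
  obtain e where e: "bij_betw e {..<n} V"
    using ex_bij_betw_nat_finite[OF V(1)] V(2) by (auto simp: atLeast0LessThan)
  have eV: "e ` {..<n} = V" and inj: "inj_on e {..<n}" using e by (auto simp: bij_betw_def)
  have "hudg \<rho> (lattice_graph K e n)" unfolding K_def using \<rho> by (rule hudg_lattice_graph)
  moreover have "real (clique_number (lattice_graph K e n)) \<le> 2 * N"
  proof (rule clique_number_lattice_graph_le[OF Kpos inj])
    fix J assume "doubling_gaps J" "J \<subseteq> fst ` e ` {..<n}"
    then show "real (card J) \<le> N" using V(4) by (intro levels) (simp_all add: eV)
  qed
  moreover have "card A \<le> 3 * (row_treewidth (lattice_graph K e n) + 1)"
    using D A K e V(3) by (rule card_le_row_treewidth_lattice_graph)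
  moreover have "num_verts (lattice_graph K e n) = n" by (simp add: num_verts_def lattice_graph_def)
  ultimately show ?thesis unfolding \<rho>_def by blast
qed

section \<open>Families of lattice graphs\<close>

lemma filterlim_num_verts: "filterlim num_verts at_top (large_members F)"
  unfolding large_members_def by (rule filterlim_mono[OF filterlim_filtercomap order_refl inf_le1])

lemma eventually_large_membersI:
  assumes "eventually P at_top" "\<And>G. G \<in> F \<Longrightarrow> P (num_verts G) \<Longrightarrow> Q G"
  shows "eventually Q (large_members F)"
  using assms unfolding eventually_large_members eventually_at_top_linorder by blast

lemma bigo_large_members:
  fixes f :: "'a pair_pre_digraph \<Rightarrow> real" and g h :: "nat \<Rightarrow> real"
  assumes fg: "\<And>G. G \<in> F \<Longrightarrow> \<bar>f G\<bar> \<le> g (num_verts G)" and gh: "g \<in> O(h)"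
  shows "f \<in> O[large_members F](\<lambda>G. h (num_verts G))"
proof -
  have "f \<in> O[large_members F](\<lambda>G. g (num_verts G))"
    by (rule bigoI[of _ 1], rule eventually_large_membersI[of "\<lambda>_. True"]) (use fg in force)+
  also have "(\<lambda>G. g (num_verts G)) \<in> O[large_members F](\<lambda>G. h (num_verts G))"
    using gh filterlim_num_verts by (rule landau_o.big.compose)
  finally show ?thesis .
qed

lemma bigomega_large_members:
  fixes f :: "'a pair_pre_digraph \<Rightarrow> real" and g h :: "nat \<Rightarrow> real"
  assumes gf: "\<And>G. G \<in> F \<Longrightarrow> g (num_verts G) \<le> f G" and pos: "eventually (\<lambda>n. 0 \<le> g n) at_top"
    and gh: "g \<in> \<Omega>(h)"
  shows "f \<in> \<Omega>[large_members F](\<lambda>G. h (num_verts G))"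
proof -
  have "(\<lambda>G. h (num_verts G)) \<in> O[large_members F](\<lambda>G. g (num_verts G))"
    using gh filterlim_num_verts unfolding bigomega_iff_bigo by (rule landau_o.big.compose)
  also have "(\<lambda>G. g (num_verts G)) \<in> O[large_members F](f)"
  proof (rule bigoI[of _ 1], rule eventually_large_membersI[OF pos])
    fix G assume "G \<in> F" "0 \<le> g (num_verts G)"
    then show "norm (g (num_verts G)) \<le> 1 * norm (f G)" using gf[of G] by simp
  qed
  finally show ?thesis unfolding bigomega_iff_bigo .
qed

text \<open>
  With \<open>r n \<le> C * ln n\<close>, the choice \<open>\<epsilon> = 1 / (6 * C)\<close> makes \<open>64 ^ D \<le> n\<close> because \<open>ln 64 \<le> 6\<close>. The
  two families differ only in the choice of \<open>A\<close>, so this is stated for an arbitrary choice together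
  with a bound \<open>N\<close> on the number of levels with doubling gaps.
\<close>

lemma lattice_graph_family_exists:
  fixes r :: "nat \<Rightarrow> real" and A :: "nat \<Rightarrow> nat set" and N :: "nat \<Rightarrow> real"
  assumes r_unbounded: "filterlim r at_top at_top" and r_log: "r \<in> O(\<lambda>n. ln (real n))"
    and A: "\<And>D. A D \<subseteq> {..<D}"
    and levels: "\<And>D J. 1 \<le> D \<Longrightarrow> doubling_gaps J \<Longrightarrow> J \<subseteq> A D \<union> {0, D, 4 * D} \<Longrightarrow> real (card J) \<le> N D"
  obtains F :: "nat pair_pre_digraph set" and \<epsilon> and D :: "nat \<Rightarrow> nat"
  where "0 < \<epsilon>" "hudg_family F r"
    "\<And>G. G \<in> F \<Longrightarrow> 1 \<le> D (num_verts G)"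
    "\<And>n. \<epsilon> * r n - 1 \<le> real (D n)"
    "\<And>G. G \<in> F \<Longrightarrow> real (D (num_verts G)) \<le> \<epsilon> * r (num_verts G)"
    "\<And>G. G \<in> F \<Longrightarrow> real (clique_number G) \<le> 2 * N (D (num_verts G))"
    "\<And>G. G \<in> F \<Longrightarrow> real (card (A (D (num_verts G)))) / 3 - 1 \<le> real (row_treewidth G)"
    "\<And>G. G \<in> F \<Longrightarrow> row_treewidth G \<le> treewidth G"
proof -
  obtain C where C: "0 < C" "eventually (\<lambda>n. norm (r n) \<le> C * norm (ln (real n))) at_top"
    using r_log by (elim landau_o.bigE) auto
  define \<epsilon> where "\<epsilon> = 1 / (6 * C)"
  have \<epsilon>: "0 < \<epsilon>" using C by (simp add: \<epsilon>_def)
  define D where "D n = nat \<lfloor>\<epsilon> * r n\<rfloor>" for n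
  have D_ge: "\<epsilon> * r n - 1 \<le> real (D n)" for n unfolding D_def by linarith
  define good where "good n \<longleftrightarrow> 1 \<le> n \<and> 1 \<le> \<epsilon> * r n \<and> \<epsilon> * r n * 6 \<le> ln (real n)" for n
  have D_le: "1 \<le> D n" "real (D n) \<le> \<epsilon> * r n" if "good n" for n
    using that unfolding good_def D_def by linarith+
  have D_pow: "64 ^ D n \<le> n" if "good n" for n
  proof -
    have "ln 64 = 6 * ln (2::real)" using ln_realpow[of "2::real" 6] by simp
    then have "ln (64::real) \<le> 6" using ln_le_minus_one[of "2::real"] by simp
    then have "real (D n) * ln 64 \<le> (\<epsilon> * r n) * 6"
      using D_le[OF that] by (intro mult_mono) auto
    also have "\<dots> \<le> ln (real n)" using that by (simp add: good_def)
    finally have "exp (real (D n) * ln 64) \<le> exp (ln (real n))" by simp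
    moreover have "exp (real (D n) * ln 64) = real (64 ^ D n)"
      by (simp add: exp_of_nat_mult)
    moreover have "exp (ln (real n)) = real n" using that by (simp add: good_def)
    ultimately show ?thesis by (simp only: of_nat_le_iff)
  qed
  have "eventually good at_top"
  proof -
    have "eventually (\<lambda>n. 1 / \<epsilon> \<le> r n) at_top"
      using r_unbounded by (simp add: filterlim_at_top)
    then show ?thesis using C(2) eventually_ge_at_top[of 1]
    proof eventually_elim
      case (elim n)
      have "0 \<le> r n" using elim(1) \<epsilon> by (meson divide_nonneg_pos less_eq_real_def order_trans zero_le_one)
      then have "r n \<le> C * ln (real n)" using elim by simp
      then have "\<epsilon> * r n * 6 \<le> ln (real n)" using C(1) by (simp add: \<epsilon>_def field_simps)
      moreover have "1 \<le> \<epsilon> * r n" using elim(1) \<epsilon> by (simp add: field_simps)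
      ultimately show ?case using elim(3) by (simp add: good_def)
    qed
  qed
  then obtain N0 where N0: "\<And>n. N0 \<le> n \<Longrightarrow> good n" by (auto simp: eventually_at_top_linorder)
  define \<rho> where "\<rho> n = (4 * real (D n) + 2) * ln 2" for n
  have "\<exists>G :: nat pair_pre_digraph. num_verts G = n \<and> hudg (\<rho> n) G \<and>
      real (clique_number G) \<le> 2 * N (D n) \<and> card (A (D n)) \<le> 3 * (row_treewidth G + 1)"
    if "good n" for n
    unfolding \<rho>_def using D_le(1)[OF that] A D_pow[OF that] levels[OF D_le(1)[OF that]]
    by (rule lattice_graph_exists)
  then obtain G :: "nat \<Rightarrow> nat pair_pre_digraph" where G: "\<And>n. good n \<Longrightarrow> num_verts (G n) = n \<and>
      hudg (\<rho> n) (G n) \<and> real (clique_number (G n)) \<le> 2 * N (D n) \<and>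
      card (A (D n)) \<le> 3 * (row_treewidth (G n) + 1)"
    by metis
  define F where "F = G ` {N0..}"
  have F: "good (num_verts H) \<and> hudg (\<rho> (num_verts H)) H \<and>
      real (clique_number H) \<le> 2 * N (D (num_verts H)) \<and>
      card (A (D (num_verts H))) \<le> 3 * (row_treewidth H + 1)" if "H \<in> F" for H
    using that G N0 by (auto simp: F_def)
  have "hudg_family F r"
    unfolding hudg_family_def
  proof (intro conjI allI exI[of _ "\<lambda>H. \<rho> (num_verts H)"])
    fix n
    have "G (max n N0) \<in> F" "n \<le> num_verts (G (max n N0))"
      using G[of "max n N0"] N0[of "max n N0"] by (auto simp: F_def)
    then show "\<exists>H\<in>F. n \<le> num_verts H" by blast
  next
    show "\<forall>H\<in>F. hudg (\<rho> (num_verts H)) H" using F by blast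
    show "(\<lambda>H. \<rho> (num_verts H)) \<in> \<Theta>[large_members F](\<lambda>H. r (num_verts H))"
    proof (rule bigthetaI)
      have "(\<lambda>n. (4 * (\<epsilon> * r n) + 2) * ln 2) \<in> O(r)"
      proof -
        have "(\<lambda>x. (4 * (\<epsilon> * x) + 2) * ln 2) \<in> O(\<lambda>x::real. x)" using \<epsilon> by real_asymp
        from landau_o.big.compose[OF this r_unbounded] show ?thesis .
      qed
      then show "(\<lambda>H. \<rho> (num_verts H)) \<in> O[large_members F](\<lambda>H. r (num_verts H))"
      proof (rule bigo_large_members[rotated])
        fix H assume "H \<in> F"
        then have "real (D (num_verts H)) \<le> \<epsilon> * r (num_verts H)" using F D_le by blast
        then show "\<bar>\<rho> (num_verts H)\<bar> \<le> (4 * (\<epsilon> * r (num_verts H)) + 2) * ln 2"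
          by (simp add: \<rho>_def abs_mult)
      qed
      have growth: "(\<lambda>n. (4 * (\<epsilon> * r n - 1) + 2) * ln 2) \<in> \<Omega>(r)"
      proof -
        have "(\<lambda>x. (4 * (\<epsilon> * x - 1) + 2) * ln 2) \<in> \<Omega>(\<lambda>x::real. x)" using \<epsilon> by real_asymp
        from landau_omega.big.compose[OF this r_unbounded] show ?thesis .
      qed
      have pos: "eventually (\<lambda>n. 0 \<le> (4 * (\<epsilon> * r n - 1) + 2) * ln 2) at_top"
      proof -
        have "eventually (\<lambda>x::real. 0 \<le> (4 * (\<epsilon> * x - 1) + 2) * ln 2) at_top" using \<epsilon> by real_asymp
        then show ?thesis using r_unbounded by (rule eventually_compose_filterlim)
      qed
      show "(\<lambda>H. \<rho> (num_verts H)) \<in> \<Omega>[large_members F](\<lambda>H. r (num_verts H))"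
      proof (rule bigomega_large_members[OF _ pos growth])
        fix H :: "nat pair_pre_digraph"
        have "4 * (\<epsilon> * r (num_verts H) - 1) \<le> 4 * real (D (num_verts H))"
          using D_ge by (rule mult_left_mono) simp
        then have "4 * (\<epsilon> * r (num_verts H) - 1) + 2 \<le> 4 * real (D (num_verts H)) + 2"
          by (rule add_right_mono)
        then show "(4 * (\<epsilon> * r (num_verts H) - 1) + 2) * ln 2 \<le> \<rho> (num_verts H)"
          unfolding \<rho>_def by (rule mult_right_mono) simp
      qed
    qed
  qed
  moreover have "real (card (A (D (num_verts H)))) / 3 - 1 \<le> real (row_treewidth H)" if "H \<in> F" for H
  proof -
    have "card (A (D (num_verts H))) \<le> 3 * (row_treewidth H + 1)" using F that by blast
    then have "real (card (A (D (num_verts H)))) \<le> real (3 * (row_treewidth H + 1))"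
      by (simp only: of_nat_le_iff)
    then show ?thesis by simp
  qed
  moreover have "row_treewidth H \<le> treewidth H" if "H \<in> F" for H
    using F[OF that] row_treewidth_le_treewidth by (auto simp: hudg_def)
  ultimately show ?thesis
    using that[of \<epsilon> F D] \<epsilon> D_ge D_le F by blast
qed

theorem corollary20:
  fixes r :: "nat \<Rightarrow> real"
  assumes r_pos: "\<And>n. 0 < r n"
    and r_unbounded: "filterlim r at_top at_top"
    and r_log: "r \<in> O(\<lambda>n. ln (real n))"
  shows
    "(\<exists>F :: nat pair_pre_digraph set. hudg_family F r \<and>
        (\<lambda>G. real (clique_number G)) \<in> O[large_members F](\<lambda>G. ln (r (num_verts G))) \<and>
        (\<lambda>G. real (treewidth G)) \<in> \<Omega>[large_members F](\<lambda>G. r (num_verts G)) \<and>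
        (\<lambda>G. real (row_treewidth G)) \<in> \<Omega>[large_members F](\<lambda>G. r (num_verts G))) \<and>
     (\<exists>F :: nat pair_pre_digraph set. hudg_family F r \<and>
        (\<lambda>G. real (clique_number G)) \<in> O[large_members F](\<lambda>_. 1) \<and>
        (\<lambda>G. real (treewidth G)) \<in> \<Omega>[large_members F](\<lambda>G. ln (r (num_verts G))) \<and>
        (\<lambda>G. real (row_treewidth G)) \<in> \<Omega>[large_members F](\<lambda>G. ln (r (num_verts G))))"
proof
  have levels: "real (card J) \<le> log 2 (32 * real D)"
    if D: "1 \<le> D" and J: "doubling_gaps J" "J \<subseteq> {..<D} \<union> {0, D, 4 * D}" for D J
  proof -
    have "J \<subseteq> {..4 * D}" using J(2) by auto
    then have "2 ^ card J \<le> 8 * (4 * D)" using D by (intro doubling_gaps_card_le_log[OF J(1)]) auto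
    then have "real (2 ^ card J) \<le> real (8 * (4 * D))" by (simp only: of_nat_le_iff)
    then show ?thesis using D by (simp add: le_log_iff powr_realpow)
  qed
  obtain F :: "nat pair_pre_digraph set" and \<epsilon> D where F: "0 < \<epsilon>" "hudg_family F r"
    "\<And>G. G \<in> F \<Longrightarrow> 1 \<le> D (num_verts G)"
    "\<And>n. \<epsilon> * r n - 1 \<le> real (D n)"
    "\<And>G. G \<in> F \<Longrightarrow> real (D (num_verts G)) \<le> \<epsilon> * r (num_verts G)"
    "\<And>G. G \<in> F \<Longrightarrow> real (clique_number G) \<le> 2 * log 2 (32 * real (D (num_verts G)))"
    "\<And>G. G \<in> F \<Longrightarrow> real (card {..<D (num_verts G)}) / 3 - 1 \<le> real (row_treewidth G)"
    "\<And>G. G \<in> F \<Longrightarrow> row_treewidth G \<le> treewidth G"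
    by (rule lattice_graph_family_exists[OF r_unbounded r_log,
          where A = lessThan and N = "\<lambda>D. log 2 (32 * real D)"]) (use levels in blast)+
  have "(\<lambda>x. 2 * log 2 (32 * (\<epsilon> * x))) \<in> O(\<lambda>x. ln x)"
    and big: "(\<lambda>x. (\<epsilon> * x - 1) / 3 - 1) \<in> \<Omega>(\<lambda>x. x)"
    and pos: "eventually (\<lambda>x. 0 \<le> (\<epsilon> * x - 1) / 3 - 1) at_top"
    using F(1) by real_asymp+
  note compose = this(1)[THEN landau_o.big.compose, OF r_unbounded]
    big[THEN landau_omega.big.compose, OF r_unbounded] eventually_compose_filterlim[OF pos r_unbounded]
  have rtw: "(\<epsilon> * r (num_verts G) - 1) / 3 - 1 \<le> real (row_treewidth G)" if "G \<in> F" for G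
    using F(4)[of "num_verts G"] F(7)[OF that] by (simp add: field_simps)
  have tw: "(\<epsilon> * r (num_verts G) - 1) / 3 - 1 \<le> real (treewidth G)" if "G \<in> F" for G
    using rtw[OF that] F(8)[OF that] by linarith
  have "\<bar>real (clique_number G)\<bar> \<le> 2 * log 2 (32 * (\<epsilon> * r (num_verts G)))" if G: "G \<in> F" for G
  proof -
    have "log 2 (32 * real (D (num_verts G))) \<le> log 2 (32 * (\<epsilon> * r (num_verts G)))"
      using F(3)[OF G] F(5)[OF G] by simp
    then show ?thesis using F(6)[OF G] by simp
  qed
  then have "(\<lambda>G. real (clique_number G)) \<in> O[large_members F](\<lambda>G. ln (r (num_verts G)))"
    using compose(1) by (rule bigo_large_members)
  moreover have "(\<lambda>G. real (row_treewidth G)) \<in> \<Omega>[large_members F](\<lambda>G. r (num_verts G))"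
    using rtw compose(3,2) by (rule bigomega_large_members)
  moreover have "(\<lambda>G. real (treewidth G)) \<in> \<Omega>[large_members F](\<lambda>G. r (num_verts G))"
    using tw compose(3,2) by (rule bigomega_large_members)
  ultimately show "\<exists>F :: nat pair_pre_digraph set. hudg_family F r \<and>
        (\<lambda>G. real (clique_number G)) \<in> O[large_members F](\<lambda>G. ln (r (num_verts G))) \<and>
        (\<lambda>G. real (treewidth G)) \<in> \<Omega>[large_members F](\<lambda>G. r (num_verts G)) \<and>
        (\<lambda>G. real (row_treewidth G)) \<in> \<Omega>[large_members F](\<lambda>G. r (num_verts G))"
    using F(2) by blast
next
  define A :: "nat \<Rightarrow> nat set" where "A D = (\<lambda>m. D - 2 ^ m) ` {m. 2 ^ m \<le> D}" for D
  have A: "A D \<subseteq> {..<D}" for D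
  proof -
    have "D - 2 ^ m < D" if "2 ^ m \<le> D" for m
      using that zero_less_power[of "2::nat" m] by linarith
    then show ?thesis by (auto simp: A_def)
  qed
  have levels: "real (card J) \<le> 6" if "doubling_gaps J" "J \<subseteq> A D \<union> {0, D, 4 * D}" for D J
    using doubling_gaps_card_le_6[of J D "4 * D"] that unfolding A_def by simp
  have card_A: "log 2 (real D) \<le> real (card (A D))" if D: "1 \<le> D" for D
  proof -
    obtain q where q: "2 ^ q \<le> D" "D < 2 ^ (q + 1)" using ex_power_ivl1[of 2 D] D by auto
    have "(\<lambda>m. D - 2 ^ m) ` {..q} \<subseteq> A D"
      unfolding A_def using q(1) by (auto intro!: image_eqI intro: order_trans[OF power_increasing])
    then have "card ((\<lambda>m. D - 2 ^ m) ` {..q}) \<le> card (A D)"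
      using finite_subset[OF A] by (intro card_mono) auto
    moreover have "inj_on (\<lambda>m. D - 2 ^ m) {..q}"
    proof (rule inj_onI)
      fix m l assume ml: "m \<in> {..q}" "l \<in> {..q}" "D - 2 ^ m = D - 2 ^ l"
      have "(2::nat) ^ m \<le> 2 ^ q" "(2::nat) ^ l \<le> 2 ^ q" using ml by (auto intro: power_increasing)
      then have "(2::nat) ^ m = 2 ^ l" using ml(3) q(1) by linarith
      then show "m = l" by simp
    qed
    ultimately have "q + 1 \<le> card (A D)" by (simp add: card_image)
    moreover have "log 2 (real D) \<le> real (q + 1)"
    proof -
      have "real D \<le> real (2 ^ (q + 1))" using q(2) by (simp only: of_nat_le_iff)
      then show ?thesis using D by (simp add: log_le_iff powr_realpow powr_add)
    qed
    ultimately show ?thesis by linarith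
  qed
  obtain F :: "nat pair_pre_digraph set" and \<epsilon> D where F: "0 < \<epsilon>" "hudg_family F r"
    "\<And>G. G \<in> F \<Longrightarrow> 1 \<le> D (num_verts G)"
    "\<And>n. \<epsilon> * r n - 1 \<le> real (D n)"
    "\<And>G. G \<in> F \<Longrightarrow> real (D (num_verts G)) \<le> \<epsilon> * r (num_verts G)"
    "\<And>G. G \<in> F \<Longrightarrow> real (clique_number G) \<le> 2 * 6"
    "\<And>G. G \<in> F \<Longrightarrow> real (card (A (D (num_verts G)))) / 3 - 1 \<le> real (row_treewidth G)"
    "\<And>G. G \<in> F \<Longrightarrow> row_treewidth G \<le> treewidth G"
    by (rule lattice_graph_family_exists[OF r_unbounded r_log, where A = A and N = "\<lambda>_. 6"])
      (use levels A in blast)+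
  \<comment> \<open>The maximum keeps the logarithm monotone also where \<open>\<epsilon> * r n - 1\<close> is small.\<close>
  define g where "g n = log 2 (max 1 (\<epsilon> * r n - 1)) / 3 - 1" for n
  have big: "(\<lambda>x. log 2 (max 1 (\<epsilon> * x - 1)) / 3 - 1) \<in> \<Omega>(\<lambda>x. ln x)"
    and pos: "eventually (\<lambda>x. 0 \<le> log 2 (max 1 (\<epsilon> * x - 1)) / 3 - 1) at_top"
    using F(1) by real_asymp+
  have g: "eventually (\<lambda>n. 0 \<le> g n) at_top" "g \<in> \<Omega>(\<lambda>n. ln (r n))"
    unfolding g_def using eventually_compose_filterlim[OF pos r_unbounded]
      landau_omega.big.compose[OF big r_unbounded] by auto
  have rtw: "g (num_verts G) \<le> real (row_treewidth G)" if G: "G \<in> F" for G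
  proof -
    have "log 2 (max 1 (\<epsilon> * r (num_verts G) - 1)) \<le> log 2 (real (D (num_verts G)))"
      using F(3)[OF G] F(4)[of "num_verts G"] by simp
    then show ?thesis using card_A[OF F(3)[OF G]] F(7)[OF G] unfolding g_def by linarith
  qed
  have tw: "g (num_verts G) \<le> real (treewidth G)" if "G \<in> F" for G
    using rtw[OF that] F(8)[OF that] by linarith
  have "(\<lambda>G. real (clique_number G)) \<in> O[large_members F](\<lambda>_. 1)"
    by (rule bigo_large_members[where g = "\<lambda>_. 12" and h = "\<lambda>_. 1"]) (use F(6) in auto)
  moreover have "(\<lambda>G. real (row_treewidth G)) \<in> \<Omega>[large_members F](\<lambda>G. ln (r (num_verts G)))"
    using rtw g by (rule bigomega_large_members)
  moreover have "(\<lambda>G. real (treewidth G)) \<in> \<Omega>[large_members F](\<lambda>G. ln (r (num_verts G)))"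
    using tw g by (rule bigomega_large_members)
  ultimately show "\<exists>F :: nat pair_pre_digraph set. hudg_family F r \<and>
        (\<lambda>G. real (clique_number G)) \<in> O[large_members F](\<lambda>_. 1) \<and>
        (\<lambda>G. real (treewidth G)) \<in> \<Omega>[large_members F](\<lambda>G. ln (r (num_verts G))) \<and>
        (\<lambda>G. real (row_treewidth G)) \<in> \<Omega>[large_members F](\<lambda>G. ln (r (num_verts G)))"
    using F(2) by blast
qed

end
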